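(* Let $i\in\mathbb{N}_0$ and let $\alpha,\beta\in\mathbb{C}$. Then $$F^{2:0;2}_{1:0;2}\left[\begin{matrix}\alpha,\ i-\alpha: & -\,; & 1-\tfrac12\alpha+\tfrac12 i,\ \tfrac{i-\alpha-\beta}{2}\,;\\ \beta: & -\,; & -\tfrac12\alpha+\tfrac12 i,\ 1+\tfrac{i-\alpha+\beta}{2}\,;\end{matrix}\ \tfrac12,\ -\tfrac12\right] =\frac{2^{i-\alpha}\,\Gamma(\alpha-i)\,\Gamma\!\left(1+\frac{\beta-\alpha+i}{2}\right)}{\Gamma(\alpha)\,\Gamma\!\left(1+\frac{\beta-3\alpha+i}{2}\right)}\sum_{r=0}^{i}(-1)^r\binom{i}{r}\frac{\Gamma\!\left(\frac{\beta-3\alpha+i}{4}+\frac{r+1}{2}\right)}{\Gamma\!\left(\frac{\beta+\alpha-3i}{4}+\frac{r+1}{2}\right)}$$ and $$F^{2:0;2}_{1:0;2}\left[\begin{matrix}\alpha,\ -\alpha-i: & -\,; & 1-\tfrac12\alpha-\tfrac12 i,\ \tfrac{-i-\alpha-\beta}{2}\,;\\ \beta: & -\,; & -\tfrac12\alpha-\tfrac12 i,\ 1+\tfrac{\beta-\alpha-i}{2}\,;\end{matrix}\ \tfrac12,\ -\tfrac12\right] =\frac{2^{-i-\alpha}\,\Gamma\!\left(1+\frac{\beta-\alpha-i}{2}\right)}{\Gamma\!\left(1+\frac{\beta-3\alpha-i}{2}\right)}\sum_{r=0}^{i}\binom{i}{r}\frac{\Gamma\!\left(\frac{\beta-3\a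lpha-i}{4}+\frac{r+1}{2}\right)}{\Gamma\!\left(\frac{\beta+\alpha-i}{4}+\frac{r+1}{2}\right)}.$$
   Context: For $\lambda\in\mathbb{C}$ and $n\in\mathbb{N}_0$, $(\lambda)_0=1$ and $(\lambda)_n=\lambda(\lambda+1)\cdots(\lambda+n-1)$; $\Gamma$ is Euler's Gamma function and $\binom{i}{r}$ the binomial coefficient. The (generalized) Kampé de Fériet function is defined by $$F^{H:A;B}_{G:C;D}\left[\begin{matrix}(h_H): & (a_A)\,; & (b_B)\,;\\ (g_G): & (c_C)\,; & (d_D)\,;\end{matrix}\ x,\ y\right]=\sum_{m=0}^\infty\sum_{n=0}^\infty\frac{\prod_{j=1}^H(h_j)_{m+n}\prod_{j=1}^A(a_j)_m\prod_{j=1}^B(b_j)_n}{\prod_{j=1}^G(g_j)_{m+n}\prod_{j=1}^C(c_j)_m\prod_{j=1}^D(d_j)_n}\frac{x^m}{m!}\frac{y^n}{n!},$$ where a dash "$-$" denotes an empty list of parameters (empty products equal $1$). Parameters are tacitly assumed to be such that the double series converges, no denominator parameter is a non-positive integer, and all Gamma values appearing are finite. *)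

theory Defs
  imports "HOL-Analysis.Analysis"
begin

definition poch_list :: "complex list \<Rightarrow> nat \<Rightarrow> complex" where
  "poch_list ps k = (\<Prod>p\<leftarrow>ps. pochhammer p k)"

text \<open>General term of the Kampe de Feriet double series
  F^{H:A;B}_{G:C;D}[(h):(a);(b); (g):(c);(d); x, y]; argument order h a b g c d x y.\<close>
definition kdf_term ::
  "complex list \<Rightarrow> complex list \<Rightarrow> complex list \<Rightarrow> complex list \<Rightarrow> complex list \<Rightarrow> complex list
   \<Rightarrow> complex \<Rightarrow> complex \<Rightarrow> nat \<Rightarrow> nat \<Rightarrow> complex" where
  "kdf_term h a b g c d x y m n =
     (poch_list h (m + n) * poch_list a m * poch_list b n) /
     (poch_list g (m + n) * poch_list c m * poch_list d n) *
     (x ^ m / fact m) * (y ^ n / fact n)"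

definition KdF ::
  "complex list \<Rightarrow> complex list \<Rightarrow> complex list \<Rightarrow> complex list \<Rightarrow> complex list \<Rightarrow> complex list
   \<Rightarrow> complex \<Rightarrow> complex \<Rightarrow> complex" where
  "KdF h a b g c d x y = (\<Sum>m. \<Sum>n. kdf_term h a b g c d x y m n)"

definition KdF_converges ::
  "complex list \<Rightarrow> complex list \<Rightarrow> complex list \<Rightarrow> complex list \<Rightarrow> complex list \<Rightarrow> complex list
   \<Rightarrow> complex \<Rightarrow> complex \<Rightarrow> bool" where
  "KdF_converges h a b g c d x y \<longleftrightarrow>
     (\<forall>m. summable (\<lambda>n. kdf_term h a b g c d x y m n)) \<and>
     summable (\<lambda>m. \<Sum>n. kdf_term h a b g c d x y m n)"

end

theory Submission
  imports Defs
begin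

text \<open>
  Write \<open>\<gamma> = \<plusminus>i - \<alpha>\<close> and \<open>d = 1 + (\<gamma> + \<beta>)/2\<close>. Along the diagonal \<open>m + n = N\<close> the double series has a
  terminating well-poised inner sum, which Chu--Vandermonde evaluates; what remains is
  \<open>\<^sub>2F\<^sub>1(\<alpha>, \<gamma> + 1; d; 1/2)\<close>, where \<open>\<alpha> + \<gamma> + 1 = 1 \<plusminus> i\<close>. For \<open>i = 0\<close> this is Bailey's theorem: for parameters
  \<open>a, 1 - a\<close> a telescoping identity relates \<open>c\<close> to \<open>c + 2\<close>, and both sides agree asymptotically as
  \<open>c \<rightarrow> \<infinity>\<close>. Contiguous relations, which mirror Pascal's rule on the right-hand side, then give all \<open>i\<close>.

  The double series need not converge absolutely, so passing to diagonals requires care. With \<open>x = s/2\<close> and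
  \<open>s < 1\<close> it does converge absolutely; as \<open>s\<close> tends to \<open>1\<close> the iterated sum is controlled by Abel's limit
  theorem, and the diagonal sums by re-expanding them in powers of \<open>s - 1\<close>.
\<close>

subsection \<open>From iterated sums to diagonal sums\<close>

text \<open>Summation by parts: with the tails \<open>R\<close>, the damped sum differs from
  \<open>suminf g\<close> by (1 - s) times the power series of the shifted tails. The first
  \<open>M\<close> tails contribute at most (1 - s) * \<open>C\<close>, which vanishes as s tends to
  1, and the remaining ones at most e/2.\<close>

lemma Abel_limit:
  fixes g :: "nat \<Rightarrow> 'a::banach"
  assumes "summable g"
  shows "((\<lambda>s. \<Sum>m. s ^ m *\<^sub>R g m) \<longlongrightarrow> suminf g) (at_left (1::real))"
proof -
  define R where "R m = (\<Sum>k. g (k + m))" for m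
  have R: "R m = suminf g - (\<Sum>k<m. g k)" for m
    unfolding R_def using suminf_minus_initial_segment[OF assms] by simp
  have g: "g m = R m - R (Suc m)" for m
    by (simp add: R)
  have "(\<lambda>m. suminf g - (\<Sum>k<m. g k)) \<longlonglongrightarrow> suminf g - suminf g"
    by (intro tendsto_intros summable_LIMSEQ assms)
  hence lim: "R \<longlonglongrightarrow> 0"
    by (simp add: R[abs_def])
  obtain B where B: "\<And>m. norm (R m) \<le> B"
    using lim convergentI[OF lim] Bseq_def convergent_imp_Bseq by metis
  have summ: "summable (\<lambda>m. s ^ m *\<^sub>R R (m + j))" if "0 < s" "s < 1" for s :: real and j
  proof (rule summable_comparison_test)
    show "summable (\<lambda>m. B * s ^ m)"
      using that by (intro summable_mult summable_geometric) auto
    show "\<exists>N. \<forall>m\<ge>N. norm (s ^ m *\<^sub>R R (m + j)) \<le> B * s ^ m"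
      using that B by (auto simp: mult.commute intro!: mult_right_mono)
  qed
  have eq: "(\<Sum>m. s ^ m *\<^sub>R g m) - suminf g = - (1 - s) *\<^sub>R (\<Sum>m. s ^ m *\<^sub>R R (m + 1))"
    if s: "0 < s" "s < 1" for s :: real
  proof -
    have "(\<Sum>m. s ^ m *\<^sub>R R (m + 0)) = R 0 + (\<Sum>m. s ^ Suc m *\<^sub>R R (Suc m + 0))"
      using suminf_split_head[OF summ[OF s, of 0]] by simp
    also have "(\<Sum>m. s ^ Suc m *\<^sub>R R (Suc m + 0)) = s *\<^sub>R (\<Sum>m. s ^ m *\<^sub>R R (m + 1))"
      using suminf_scaleR_right[OF summ[OF s, of 1], of s] by simp
    finally have split: "(\<Sum>m. s ^ m *\<^sub>R R (m + 0)) = R 0 + s *\<^sub>R (\<Sum>m. s ^ m *\<^sub>R R (m + 1))" .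
    have "(\<Sum>m. s ^ m *\<^sub>R g m) = (\<Sum>m. s ^ m *\<^sub>R R (m + 0)) - (\<Sum>m. s ^ m *\<^sub>R R (m + 1))"
      by (subst suminf_diff[OF summ[OF s] summ[OF s]]) (simp add: g scaleR_diff_right)
    also have "\<dots> = R 0 - (1 - s) *\<^sub>R (\<Sum>m. s ^ m *\<^sub>R R (m + 1))"
      unfolding split by (simp add: algebra_simps)
    finally show ?thesis
      by (simp add: R algebra_simps)
  qed
  have "\<forall>\<^sub>F s in at_left 1. dist (\<Sum>m. s ^ m *\<^sub>R g m) (suminf g) < e" if e: "e > 0" for e
  proof -
    obtain M where M: "\<And>m. m \<ge> M \<Longrightarrow> norm (R m) < e / 2"
      using LIMSEQ_D[OF lim, of "e / 2"] e by auto
    define C where "C = (\<Sum>m<M. norm (R (m + 1)))"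
    have C0: "C \<ge> 0" by (simp add: C_def sum_nonneg)
    have bound: "dist (\<Sum>m. s ^ m *\<^sub>R g m) (suminf g) \<le> (1 - s) * C + e / 2"
      if s: "0 < s" "s < 1" for s :: real
    proof -
      let ?h = "\<lambda>m. (if m \<in> {..<M} then norm (R (m + 1)) else 0) + e / 2 * s ^ m"
      have geo: "(\<lambda>m. e / 2 * s ^ m) sums (e / 2 * (1 / (1 - s)))"
        using s by (intro sums_mult geometric_sums) auto
      have h: "?h sums (C + e / 2 * (1 / (1 - s)))"
        unfolding C_def by (intro sums_add geo sums_If_finite_set) auto
      have le: "norm (s ^ m *\<^sub>R R (m + 1)) \<le> ?h m" for m
      proof (cases "m < M")
        case True
        have "s ^ m * norm (R (m + 1)) \<le> 1 * norm (R (m + 1))"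
          using s by (intro mult_right_mono power_le_one) auto
        thus ?thesis using True s e by (simp add: add_increasing2)
      next
        case False
        have "s ^ m * norm (R (m + 1)) \<le> s ^ m * (e / 2)"
          using s M[of "m + 1"] False by (intro mult_left_mono) auto
        thus ?thesis using False s by (simp add: mult_ac)
      qed
      have "norm (\<Sum>m. s ^ m *\<^sub>R R (m + 1)) \<le> C + e / 2 * (1 / (1 - s))"
        by (metis (no_types, lifting) h le norm_suminf_le sums_iff)
      hence "(1 - s) * norm (\<Sum>m. s ^ m *\<^sub>R R (m + 1)) \<le> (1 - s) * (C + e / 2 * (1 / (1 - s)))"
        using s by (intro mult_left_mono) auto
      also have "\<dots> = (1 - s) * C + e / 2"
        using s by (simp add: field_simps)
      finally show ?thesis
        using s by (simp add: dist_norm eq)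
    qed
    have "((\<lambda>s. (1 - s) * C + e / 2) \<longlongrightarrow> (1 - 1) * C + e / 2) (at_left 1)"
      by (intro tendsto_intros)
    hence "\<forall>\<^sub>F s in at_left 1. (1 - s) * C + e / 2 < e"
      by (rule order_tendstoD) (use e in auto)
    moreover have "\<forall>\<^sub>F s in at_left (1::real). s \<in> {0<..<1}"
      by (rule eventually_at_left_real) auto
    ultimately show ?thesis
      by eventually_elim (use bound in fastforce)
  qed
  thus ?thesis
    by (rule tendstoI)
qed

section \<open>Geometric bounds and subexponential sequences\<close>

text \<open>From some \<open>N\<close> on, each step multiplies the norm by at most
  \<open>q\<close>; \<open>K\<close> is large enough to cover the finitely many terms before. The
  recursion is assumed only eventually because denominators such as c + n may vanish for small
  n.\<close>

lemma geometric_bound_of_ratio: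
  fixes f r :: "nat \<Rightarrow> 'a::real_normed_field"
  assumes rec: "\<forall>\<^sub>F n in sequentially. f (Suc n) = r n * f n"
    and lim: "(\<lambda>n. norm (r n)) \<longlonglongrightarrow> L" and q: "L < q" "0 < q"
  obtains K where "K \<ge> 0" "\<And>n. norm (f n) \<le> K * q ^ n"
proof -
  have "\<forall>\<^sub>F n in sequentially. norm (f (Suc n)) \<le> q * norm (f n)"
    using rec order_tendstoD(2)[OF lim q(1)]
    by eventually_elim (auto simp: norm_mult intro!: mult_right_mono)
  then obtain N where N: "\<And>n. n \<ge> N \<Longrightarrow> norm (f (Suc n)) \<le> q * norm (f n)"
    by (auto simp: eventually_sequentially)
  define K where "K = (\<Sum>n\<le>N. norm (f n) / q ^ n)"
  have K: "norm (f n) / q ^ n \<le> K" if "n \<le> N" for n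
    unfolding K_def using that q by (intro member_le_sum) auto
  have "norm (f n) \<le> K * q ^ n" for n
  proof (induction n)
    case 0
    show ?case using K[of 0] by simp
  next
    case (Suc n)
    show ?case
    proof (cases "Suc n \<le> N")
      case True
      thus ?thesis using K[of "Suc n"] q by (simp add: field_simps)
    next
      case False
      hence "norm (f (Suc n)) \<le> q * norm (f n)" by (intro N) auto
      also have "\<dots> \<le> q * (K * q ^ n)" using Suc q by (intro mult_left_mono) auto
      finally show ?thesis by (simp add: mult_ac)
    qed
  qed
  moreover have "K \<ge> 0" unfolding K_def using q by (intro sum_nonneg) auto
  ultimately show ?thesis by (rule that[rotated])
qed

text \<open>Asking for every q > 1 makes the class closed under products, since q splits as sqrt q *
  sqrt q.\<close>

definition subexponential :: "(nat \<Rightarrow> 'a::real_normed_vector) \<Rightarrow> bool" where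
  "subexponential f \<longleftrightarrow> (\<forall>q>1. \<exists>K\<ge>0. \<forall>n. norm (f n) \<le> K * q ^ n)"

lemma subexponentialE:
  assumes "subexponential f" "q > 1"
  obtains K where "K \<ge> 0" "\<And>n. norm (f n) \<le> K * q ^ n"
  using assms unfolding subexponential_def by blast

lemma subexponential_mult:
  fixes f g :: "nat \<Rightarrow> 'a::real_normed_field"
  assumes "subexponential f" "subexponential g"
  shows "subexponential (\<lambda>n. f n * g n)"
  unfolding subexponential_def
proof (intro allI impI)
  fix q :: real assume "q > 1"
  hence q: "sqrt q > 1" by simp
  obtain K where K: "K \<ge> 0" "\<And>n. norm (f n) \<le> K * sqrt q ^ n"
    using subexponentialE[OF assms(1) q] by blast
  obtain K' where K': "K' \<ge> 0" "\<And>n. norm (g n) \<le> K' * sqrt q ^ n"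
    using subexponentialE[OF assms(2) q] by blast
  have "norm (f n * g n) \<le> K * K' * q ^ n" for n
  proof -
    have "norm (f n * g n) \<le> (K * sqrt q ^ n) * (K' * sqrt q ^ n)"
      unfolding norm_mult using K K' q by (intro mult_mono) auto
    also have "\<dots> = K * K' * (sqrt q * sqrt q) ^ n"
      by (simp add: power_mult_distrib del: real_sqrt_mult_self)
    finally show ?thesis using \<open>q > 1\<close> by simp
  qed
  thus "\<exists>K\<ge>0. \<forall>n. norm (f n * g n) \<le> K * q ^ n"
    using K K' by (intro exI[of _ "K * K'"]) auto
qed

lemma subexponential_const: "subexponential (\<lambda>_. c)"
  unfolding subexponential_def
proof (intro allI impI)
  fix q :: real assume "q > 1"
  thus "\<exists>K\<ge>0. \<forall>n::nat. norm c \<le> K * q ^ n"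
    by (intro exI[of _ "norm c"]) (auto intro!: mult_left_mono[where a=1 and c="norm c", simplified])
qed

lemma tendsto_shifted_quotient:
  fixes a b :: "'a::real_normed_field"
  shows "(\<lambda>n. (a + of_nat n) / (b + of_nat n)) \<longlonglongrightarrow> 1"
proof -
  have "(\<lambda>n. (a / of_nat n + 1) / (b / of_nat n + 1)) \<longlonglongrightarrow> (0 + 1) / (0 + 1)"
    by (intro tendsto_intros tendsto_divide_0[OF tendsto_const] tendsto_of_nat) auto
  moreover have "\<forall>\<^sub>F n in sequentially. (a / of_nat n + 1) / (b / of_nat n + 1) =
      (a + of_nat n) / (b + of_nat n)"
    using eventually_gt_at_top[of 0]
  proof eventually_elim
    case (elim n)
    hence n: "(of_nat n :: 'a) \<noteq> 0" by simp
    have "a / of_nat n + 1 = (a + of_nat n) / of_nat n" "b / of_nat n + 1 = (b + of_nat n) / of_nat n"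
      using n by (simp_all add: add_divide_distrib)
    thus ?case using n by simp
  qed
  ultimately show ?thesis
    by (simp add: tendsto_cong)
qed

lemma subexponential_ratio:
  fixes f r :: "nat \<Rightarrow> 'a::real_normed_field"
  assumes "\<forall>\<^sub>F n in sequentially. f (Suc n) = r n * f n" and "r \<longlonglongrightarrow> 1"
  shows "subexponential f"
  unfolding subexponential_def
proof (intro allI impI)
  fix q :: real assume q: "q > 1"
  have "(\<lambda>n. norm (r n)) \<longlonglongrightarrow> 1"
    using tendsto_norm[OF assms(2)] by simp
  from geometric_bound_of_ratio[OF assms(1) this q] q
  show "\<exists>K\<ge>0. \<forall>n. norm (f n) \<le> K * q ^ n"
    by (metis order.strict_trans zero_less_one)
qed

text \<open>The ratio recursion survives zeros of the denominator: from the first vanishing factor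
  of \<open>pochhammer b\<close> on, both sides are 0 because division by zero yields 0.\<close>

lemma subexponential_pochhammer_ratio:
  fixes a b :: "'a::real_normed_field"
  shows "subexponential (\<lambda>n. pochhammer a n / pochhammer b n)"
  by (rule subexponential_ratio[OF _ tendsto_shifted_quotient[of a b]])
     (simp add: pochhammer_rec')

lemma eventually_add_of_nat_neq_0:
  "\<forall>\<^sub>F n in sequentially. a + of_nat n \<noteq> (0 :: 'a::real_normed_field)"
proof -
  obtain k where "norm a < of_nat k" using reals_Archimedean2 by blast
  hence "a + of_nat n \<noteq> 0" if "n \<ge> k" for n
    using that by (metis add_eq_0_iff norm_minus_cancel norm_of_nat not_less of_nat_le_iff)
  thus ?thesis
    using eventually_sequentially by blast
qed

lemma subexponential_add_of_nat:
  "subexponential (\<lambda>n. c + of_nat n :: 'a::real_normed_field)"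
  by (rule subexponential_ratio[OF _ tendsto_shifted_quotient[of "c + 1" c]])
     (use eventually_add_of_nat_neq_0[of c] in eventually_elim, simp add: add_ac)

section \<open>Damped double series and their diagonal sums\<close>

text \<open>Expand \<open>(x + 1) ^ (N - n)\<close> and swap the sums; both products of binomials in
  \<open>choose\<close> count the disjoint pairs of an n-subset and a k-subset. With x = s - 1 this
  expands a damped diagonal sum around s = 1, the coefficients being undamped diagonal sums.\<close>

lemma binomial_transform_shift:
  fixes x :: "'a::comm_ring_1"
  shows "(\<Sum>n\<le>N. of_nat (N choose n) * (x + 1) ^ (N - n) * f n) =
         (\<Sum>k\<le>N. of_nat (N choose k) * x ^ k * (\<Sum>n\<le>N - k. of_nat ((N - k) choose n) * f n))"
proof -
  have choose: "(N choose n) * ((N - n) choose k) = (N choose k) * ((N - k) choose n)" for n k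
  proof (cases "n + k \<le> N")
    case True
    thus ?thesis
      using choose_mult[of n "n + k" N] choose_mult[of k "n + k" N]
      by (simp add: binomial_symmetric[of n "n + k"])
  next
    case False
    thus ?thesis by (cases "n \<le> N"; cases "k \<le> N") (auto simp: binomial_eq_0)
  qed
  have "(\<Sum>n\<le>N. of_nat (N choose n) * (x + 1) ^ (N - n) * f n) =
        (\<Sum>n\<le>N. \<Sum>k\<le>N. of_nat ((N choose n) * ((N - n) choose k)) * x ^ k * f n)"
  proof (rule sum.cong[OF refl])
    fix n assume "n \<in> {..N}"
    have "(x + 1) ^ (N - n) = (\<Sum>k\<le>N - n. of_nat ((N - n) choose k) * x ^ k)"
      by (simp add: binomial_ring)
    also have "\<dots> = (\<Sum>k\<le>N. of_nat ((N - n) choose k) * x ^ k)"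
      by (rule sum.mono_neutral_left) (auto simp: binomial_eq_0)
    finally show "of_nat (N choose n) * (x + 1) ^ (N - n) * f n =
        (\<Sum>k\<le>N. of_nat ((N choose n) * ((N - n) choose k)) * x ^ k * f n)"
      by (simp add: sum_distrib_left sum_distrib_right mult_ac)
  qed
  also have "\<dots> = (\<Sum>k\<le>N. \<Sum>n\<le>N. of_nat ((N choose k) * ((N - k) choose n)) * x ^ k * f n)"
    by (subst sum.swap) (simp add: choose)
  also have "\<dots> = (\<Sum>k\<le>N. of_nat (N choose k) * x ^ k * (\<Sum>n\<le>N - k. of_nat ((N - k) choose n) * f n))"
  proof (rule sum.cong[OF refl])
    fix k assume "k \<in> {..N}"
    have "(\<Sum>n\<le>N - k. of_nat ((N - k) choose n) * f n) = (\<Sum>n\<le>N. of_nat ((N - k) choose n) * f n)"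
      by (rule sum.mono_neutral_left) (auto simp: binomial_eq_0)
    thus "(\<Sum>n\<le>N. of_nat ((N choose k) * ((N - k) choose n)) * x ^ k * f n) =
        of_nat (N choose k) * x ^ k * (\<Sum>n\<le>N - k. of_nat ((N - k) choose n) * f n)"
      by (simp add: sum_distrib_left mult_ac)
  qed
  finally show ?thesis .
qed

text \<open>For s < 1 the absolute values along diagonal N add up to at most a constant times (q(s +
  q)/2)^N. Once this ratio is below 1, absolute summability permits summing by rows or by
  diagonals.\<close>

lemma damped_diagonal_sum:
  fixes \<phi> \<psi> :: "nat \<Rightarrow> complex" and s :: real
  assumes "subexponential \<phi>" "subexponential \<psi>" and s: "0 < s" "s < 1"
  shows "(\<Sum>m. s ^ m *\<^sub>R (\<Sum>n. \<phi> (m + n) * of_nat ((m + n) choose n) * (-1) ^ n * \<psi> n / 2 ^ (m + n))) =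
         (\<Sum>N. \<phi> N / 2 ^ N * (\<Sum>n\<le>N. of_nat (N choose n) * of_real s ^ (N - n) * ((-1) ^ n * \<psi> n)))"
proof -
  define t where "t m n = \<phi> (m + n) * of_nat ((m + n) choose n) * (-1) ^ n * \<psi> n / 2 ^ (m + n)" for m n
  define v where "v = (\<lambda>(N, n). \<phi> N / 2 ^ N * (of_nat (N choose n) * of_real s ^ (N - n) * ((-1) ^ n * \<psi> n)))"
  \<comment> \<open>Close enough to 1 that q(s + q) < 2, although s + q may itself be arbitrarily
    near 2.\<close>
  define q where "q = 1 + (1 - s) / 4"
  have q: "q > 1" using s by (simp add: q_def)
  have "2 - q * (s + q) = (1 - s) * (4 + 3 * (1 - s)) / 16"
    by (simp add: q_def field_simps)
  moreover have "(1 - s) * (4 + 3 * (1 - s)) / 16 > 0"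
    using s by (intro divide_pos_pos mult_pos_pos) auto
  ultimately have "q * (s + q) < 2"
    by linarith
  define \<rho> where "\<rho> = q * (s + q) / 2"
  have \<rho>: "0 < \<rho>" "\<rho> < 1" using q s \<open>q * (s + q) < 2\<close> by (auto simp: \<rho>_def)
  obtain K where K: "K \<ge> 0" "\<And>n. norm (\<phi> n) \<le> K * q ^ n"
    using subexponentialE[OF assms(1) q] by blast
  obtain L where L: "L \<ge> 0" "\<And>n. norm (\<psi> n) \<le> L * q ^ n"
    using subexponentialE[OF assms(2) q] by blast
  have bound: "(\<Sum>n\<le>N. norm (v (N, n))) \<le> K * L * \<rho> ^ N" for N
  proof -
    have "(\<Sum>n\<le>N. norm (v (N, n))) =
        norm (\<phi> N) / 2 ^ N * (\<Sum>n\<le>N. of_nat (N choose n) * s ^ (N - n) * norm (\<psi> n))"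
      using s by (simp add: v_def norm_mult norm_divide norm_power sum_distrib_left mult_ac)
    also have "\<dots> \<le> (K * q ^ N) / 2 ^ N * (\<Sum>n\<le>N. of_nat (N choose n) * s ^ (N - n) * (L * q ^ n))"
      using s K L q by (intro mult_mono divide_right_mono sum_mono sum_nonneg) auto
    also have "(\<Sum>n\<le>N. of_nat (N choose n) * s ^ (N - n) * (L * q ^ n)) = L * (s + q) ^ N"
      by (subst add.commute) (simp add: binomial_ring sum_distrib_left mult_ac)
    also have "(K * q ^ N) / 2 ^ N * (L * (s + q) ^ N) = K * L * \<rho> ^ N"
      by (simp add: \<rho>_def power_divide power_mult_distrib)
    finally show ?thesis .
  qed
  have "(\<lambda>N. \<Sum>n\<le>N. norm (v (N, n))) summable_on UNIV"
  proof (rule norm_summable_imp_summable_on, rule summable_comparison_test)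
    show "summable (\<lambda>N. K * L * \<rho> ^ N)"
      using \<rho> by (intro summable_mult summable_geometric) auto
    show "\<exists>N. \<forall>n\<ge>N. norm (norm (\<Sum>na\<le>n. norm (v (n, na)))) \<le> K * L * \<rho> ^ n"
      using bound by (auto simp: sum_nonneg)
  qed
  hence "(\<lambda>x. norm (v x)) summable_on (SIGMA N:UNIV. {..N})"
    by (subst Infinite_Sum.abs_summable_on_Sigma_iff) (auto simp: sum_nonneg)
  hence "v summable_on (SIGMA N:UNIV. {..N})"
    by (rule abs_summable_summable)
  then obtain S where S: "(v has_sum S) (SIGMA N:UNIV. {..N})"
    by (auto simp: summable_on_def)
  have "((\<lambda>N. \<Sum>n\<le>N. v (N, n)) has_sum S) UNIV"
    by (rule has_sum_SigmaD[OF S]) (simp add: has_sum_finite)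
  hence "S = (\<Sum>N. \<Sum>n\<le>N. v (N, n))"
    by (meson has_sum_imp_sums sums_unique)
  hence diag: "S = (\<Sum>N. \<phi> N / 2 ^ N * (\<Sum>n\<le>N. of_nat (N choose n) * of_real s ^ (N - n) * ((-1) ^ n * \<psi> n)))"
    by (simp add: v_def sum_distrib_left)
  have bij: "bij_betw (\<lambda>(m, n). (m + n, n)) (UNIV \<times> UNIV) (SIGMA N:UNIV. {..N::nat})"
    by (rule bij_betwI[where g = "\<lambda>(N, n). (N - n, n)"]) auto
  have u: "((\<lambda>(m, n). s ^ m *\<^sub>R t m n) has_sum S) (UNIV \<times> UNIV)"
  proof -
    have "((\<lambda>x. v (case x of (m, n) \<Rightarrow> (m + n, n))) has_sum S) (UNIV \<times> UNIV)"
      using S has_sum_reindex_bij_betw[OF bij] by blast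
    moreover have "(\<lambda>x. v (case x of (m, n) \<Rightarrow> (m + n, n))) = (\<lambda>(m, n). s ^ m *\<^sub>R t m n)"
      by (auto simp: v_def t_def fun_eq_iff scaleR_conv_of_real)
    ultimately show ?thesis by simp
  qed
  \<comment> \<open>Since s > 0, dividing by \<open>s ^ m\<close> turns the sum of a damped row into
    the undamped inner sum of the iterated series.\<close>
  have row: "((\<lambda>n. s ^ m *\<^sub>R t m n) has_sum (s ^ m *\<^sub>R (\<Sum>n. t m n))) UNIV" for m
  proof -
    have "(\<lambda>n. s ^ m *\<^sub>R t m n) summable_on UNIV"
      by (rule summable_on_SigmaD1[where A = UNIV]) (use u in \<open>auto simp: summable_on_def\<close>)
    then obtain c where c: "((\<lambda>n. s ^ m *\<^sub>R t m n) has_sum c) UNIV"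
      by (auto simp: summable_on_def)
    have "(\<lambda>n. inverse (s ^ m) *\<^sub>R (s ^ m *\<^sub>R t m n)) sums (inverse (s ^ m) *\<^sub>R c)"
      by (intro sums_scaleR_right has_sum_imp_sums c)
    hence "(\<Sum>n. t m n) = inverse (s ^ m) *\<^sub>R c"
      using s by (simp add: sums_iff)
    thus ?thesis using c s by simp
  qed
  have "((\<lambda>m. s ^ m *\<^sub>R (\<Sum>n. t m n)) has_sum S) UNIV"
    by (rule has_sum_SigmaD[OF u]) (simp add: row)
  hence "(\<Sum>m. s ^ m *\<^sub>R (\<Sum>n. t m n)) = S"
    by (intro sums_unique[symmetric] has_sum_imp_sums)
  thus ?thesis
    unfolding diag t_def .
qed

text \<open>The Weierstrass M-test on an interval reaching up to 1, so that the value at s = 1 is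
  the left limit. The growth hypothesis concerns the alternating binomial sums of \<psi>, not \<psi>
  itself.\<close>

lemma continuous_on_diagonal_sum:
  fixes \<phi> \<psi> :: "nat \<Rightarrow> complex"
  assumes "subexponential \<phi>"
    and "subexponential (\<lambda>N. \<Sum>n\<le>N. of_nat (N choose n) * ((-1) ^ n * \<psi> n))"
  shows "continuous_on {1/2..1::real} (\<lambda>s. \<Sum>N. \<phi> N / 2 ^ N *
           (\<Sum>n\<le>N. of_nat (N choose n) * of_real s ^ (N - n) * ((-1) ^ n * \<psi> n)))"
proof -
  define p where "p N = (\<Sum>n\<le>N. of_nat (N choose n) * ((-1) ^ n * \<psi> n))" for N
  define P where "P N s = (\<Sum>n\<le>N. of_nat (N choose n) * of_real s ^ (N - n) * ((-1) ^ n * \<psi> n))"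
    for N and s :: real
  \<comment> \<open>As |s - 1| is at most 1/2, the majorant has ratio q(1/2 + q)/2, here
    0.88.\<close>
  define q :: real where "q = 11 / 10"
  have q: "q > 1" by (simp add: q_def)
  obtain K where K: "K \<ge> 0" "\<And>n. norm (\<phi> n) \<le> K * q ^ n"
    using subexponentialE[OF assms(1) q] by blast
  obtain L where L: "L \<ge> 0" "\<And>n. norm (p n) \<le> L * q ^ n"
    using subexponentialE[OF assms(2) q] unfolding p_def by blast
  \<comment> \<open>Bounding \<open>P N s\<close> term by term only gives \<open>2 ^ N\<close> near \<open>s = 1\<close>; expanding in powers of \<open>s - 1\<close>
    exposes the cancellation, since the coefficients are the subexponential \<open>p\<close>.\<close>
  have P: "norm (P N s) \<le> L * (1/2 + q) ^ N" if s: "s \<in> {1/2..1}" for N s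
  proof -
    have "P N s = (\<Sum>n\<le>N. of_nat (N choose n) * (of_real (s - 1) + 1) ^ (N - n) * ((-1) ^ n * \<psi> n))"
      by (simp add: P_def)
    also have "\<dots> = (\<Sum>k\<le>N. of_nat (N choose k) * of_real (s - 1) ^ k * p (N - k))"
      unfolding p_def by (rule binomial_transform_shift)
    also have "norm \<dots> \<le> (\<Sum>k\<le>N. of_nat (N choose k) * (1 / 2) ^ k * (L * q ^ (N - k)))"
    proof (rule sum_norm_le)
      fix k assume "k \<in> {..N}"
      have "norm (of_real (s - 1) :: complex) ^ k \<le> (1/2) ^ k"
        unfolding norm_of_real using s by (intro power_mono) auto
      thus "norm (of_nat (N choose k) * of_real (s - 1) ^ k * p (N - k)) \<le>
            of_nat (N choose k) * (1 / 2) ^ k * (L * q ^ (N - k))"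
        unfolding norm_mult norm_power norm_of_nat
        using L by (intro mult_mono) auto
    qed
    also have "\<dots> = L * (1/2 + q) ^ N"
      by (simp add: binomial_ring sum_distrib_left mult_ac)
    finally show ?thesis .
  qed
  have "uniform_limit {1/2..1} (\<lambda>n s. \<Sum>N<n. \<phi> N / 2 ^ N * P N s) (\<lambda>s. \<Sum>N. \<phi> N / 2 ^ N * P N s) sequentially"
  proof (rule Weierstrass_m_test)
    show "summable (\<lambda>N. K * L * (q * (1/2 + q) / 2) ^ N)"
      by (intro summable_mult summable_geometric) (simp add: q_def)
    fix N and s :: real assume s: "s \<in> {1/2..1}"
    have "norm (\<phi> N / 2 ^ N * P N s) \<le> (K * q ^ N) / 2 ^ N * (L * (1/2 + q) ^ N)"
      unfolding norm_mult norm_divide norm_power using K P[OF s] L q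
      by (intro mult_mono divide_mono) auto
    thus "norm (\<phi> N / 2 ^ N * P N s) \<le> K * L * (q * (1/2 + q) / 2) ^ N"
      by (simp add: power_divide power_mult_distrib mult_ac)
  qed
  moreover have "\<forall>\<^sub>F n in sequentially. continuous_on {1/2..1} (\<lambda>s. \<Sum>N<n. \<phi> N / 2 ^ N * P N s)"
    unfolding P_def by (intro always_eventually allI continuous_intros)
  ultimately show ?thesis
    unfolding P_def by (intro uniform_limit_theorem) auto
qed

text \<open>For 0 < s < 1 the damped iterated series equals \<open>D s\<close>. As s tends to 1 from
  below, the former tends to the iterated sum by Abel's theorem and the latter to \<open>D 1\<close>
  by continuity. The growth of \<psi> serves the identity for s < 1, that of \<open>p\<close> the
  continuity at 1.\<close>

lemma alternating_double_series:
  fixes \<phi> \<psi> :: "nat \<Rightarrow> complex"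
  defines "p \<equiv> (\<lambda>N. \<Sum>n\<le>N. of_nat (N choose n) * ((-1) ^ n * \<psi> n))"
  assumes sub: "subexponential \<phi>" "subexponential \<psi>" "subexponential p"
    and summ: "summable (\<lambda>m. \<Sum>n. \<phi> (m + n) * of_nat ((m + n) choose n) * (-1) ^ n * \<psi> n / 2 ^ (m + n))"
  shows "(\<Sum>m. \<Sum>n. \<phi> (m + n) * of_nat ((m + n) choose n) * (-1) ^ n * \<psi> n / 2 ^ (m + n)) =
         (\<Sum>N. \<phi> N * p N / 2 ^ N)"
proof -
  define D where "D s = (\<Sum>N. \<phi> N / 2 ^ N *
           (\<Sum>n\<le>N. of_nat (N choose n) * of_real s ^ (N - n) * ((-1) ^ n * \<psi> n)))" for s :: real
  have "continuous_on {1/2..1} D"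
    unfolding D_def using continuous_on_diagonal_sum sub(1,3) by (simp add: p_def)
  hence "(D \<longlongrightarrow> D 1) (at 1 within {1/2..1})"
    by (auto simp: continuous_on_def)
  hence lim: "(D \<longlongrightarrow> D 1) (at_left 1)"
    by (subst (asm) at_within_Icc_at_left) auto
  have "\<forall>\<^sub>F s in at_left (1::real). s \<in> {0<..<1}"
    by (rule eventually_at_left_real) auto
  hence "\<forall>\<^sub>F s in at_left (1::real). (\<Sum>m. s ^ m *\<^sub>R (\<Sum>n. \<phi> (m + n) *
      of_nat ((m + n) choose n) * (-1) ^ n * \<psi> n / 2 ^ (m + n))) = D s"
    unfolding D_def by eventually_elim (rule damped_diagonal_sum, use sub in auto)
  hence "(D \<longlongrightarrow> (\<Sum>m. \<Sum>n. \<phi> (m + n) * of_nat ((m + n) choose n) * (-1) ^ n * \<psi> n / 2 ^ (m + n))) (at_left 1)"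
    using Abel_limit[OF summ] by (simp add: tendsto_cong)
  from tendsto_unique[OF _ this lim] show ?thesis
    by (simp add: D_def p_def)
qed

subsection \<open>Evaluation of the diagonal sums\<close>

text \<open>Pascal's rule in summed form. It drives the induction for Chu-Vandermonde and, later,
  both inductions on \<open>i\<close>.\<close>

lemma sum_choose_Suc:
  fixes f :: "nat \<Rightarrow> 'a::comm_ring_1"
  shows "(\<Sum>n\<le>Suc N. of_nat (Suc N choose n) * f n) = (\<Sum>n\<le>N. of_nat (N choose n) * (f n + f (Suc n)))"
proof -
  have "(\<Sum>n\<le>Suc N. of_nat (Suc N choose n) * f n) =
      f 0 + (\<Sum>n\<le>N. of_nat (N choose Suc n) * f (Suc n)) + (\<Sum>n\<le>N. of_nat (N choose n) * f (Suc n))"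
    by (simp add: sum.atMost_Suc_shift sum.distrib algebra_simps del: sum.atMost_Suc)
  also have "f 0 + (\<Sum>n\<le>N. of_nat (N choose Suc n) * f (Suc n)) = (\<Sum>n\<le>Suc N. of_nat (N choose n) * f n)"
    by (simp add: sum.atMost_Suc_shift del: sum.atMost_Suc)
  also have "\<dots> = (\<Sum>n\<le>N. of_nat (N choose n) * f n)"
    by (simp add: binomial_eq_0)
  finally show ?thesis
    by (simp add: sum.distrib distrib_left)
qed

text \<open>Pascal's rule reduces the sum for Suc N at (b, d) to the sums for N at (b, d) and (b +
  1, d + 1), hence the induction with \<open>b\<close> and \<open>d\<close> arbitrary. The
  difference d - b is the same for both pairs.\<close>

lemma Chu_Vandermonde_pochhammer:
  fixes b d :: complex
  assumes "d \<notin> \<int>\<^sub>\<le>\<^sub>0"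
  shows "(\<Sum>n\<le>N. of_nat (N choose n) * ((-1) ^ n * (pochhammer b n / pochhammer d n))) =
         pochhammer (d - b) N / pochhammer d N"
  using assms
proof (induction N arbitrary: b d)
  case (Suc N)
  let ?S = "\<lambda>b d. \<Sum>n\<le>N. of_nat (N choose n) * ((-1) ^ n * (pochhammer b n / pochhammer d n))"
  have d: "d + 1 \<notin> \<int>\<^sub>\<le>\<^sub>0" "d \<noteq> 0" "d + of_nat N \<noteq> 0"
    using Suc.prems plus_one_in_nonpos_Ints_imp plus_of_nat_eq_0_imp by auto
  have nz: "pochhammer d N \<noteq> 0"
    using Suc.prems pochhammer_eq_0_imp_nonpos_Int by blast
  have "(\<Sum>n\<le>Suc N. of_nat (Suc N choose n) * ((-1) ^ n * (pochhammer b n / pochhammer d n))) =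
        ?S b d - b / d * ?S (b + 1) (d + 1)"
    unfolding sum_choose_Suc sum_distrib_left sum_subtractf[symmetric]
    by (intro sum.cong) (simp_all add: pochhammer_rec algebra_simps)
  also have "\<dots> = pochhammer (d - b) N / pochhammer d N - b / d * (pochhammer (d - b) N / pochhammer (d + 1) N)"
    using Suc.IH[OF Suc.prems, of b] Suc.IH[OF d(1), of "b + 1"] by simp
  also have "b / d * (pochhammer (d - b) N / pochhammer (d + 1) N) = b * pochhammer (d - b) N / pochhammer d (Suc N)"
    by (simp add: pochhammer_rec)
  also have "pochhammer (d - b) N / pochhammer d N - \<dots> = pochhammer (d - b) (Suc N) / pochhammer d (Suc N)"
    using nz d(3) by (simp add: pochhammer_Suc divide_simps) algebra
  finally show ?case .
qed auto

lemma sum_choose_weighted: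
  fixes f :: "nat \<Rightarrow> 'a::comm_ring_1"
  shows "(\<Sum>n\<le>Suc N. of_nat (Suc N choose n) * (of_nat n * f n)) =
         of_nat (Suc N) * (\<Sum>n\<le>N. of_nat (N choose n) * f (Suc n))"
proof -
  have "(\<Sum>n\<le>Suc N. of_nat (Suc N choose n) * (of_nat n * f n)) =
        (\<Sum>n\<le>N. of_nat (Suc n * (Suc N choose Suc n)) * f (Suc n))"
    by (subst sum.atMost_Suc_shift) (simp only: of_nat_mult mult_ac of_nat_0 mult_zero_left mult_zero_right add_0_left)
  also have "\<dots> = of_nat (Suc N) * (\<Sum>n\<le>N. of_nat (N choose n) * f (Suc n))"
    by (simp only: Suc_times_binomial of_nat_mult sum_distrib_left mult.assoc)
  finally show ?thesis .
qed

text \<open>A parameter pair 1 + x over x thus acts as a linear weight in n, which splits the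
  well-poised sum into two Chu-Vandermonde sums.\<close>

lemma pochhammer_quotient_Suc:
  fixes x :: complex
  assumes "x \<notin> \<int>\<^sub>\<le>\<^sub>0"
  shows "pochhammer (1 + x) n / pochhammer x n = 1 + of_nat n / x"
proof -
  have "pochhammer x n \<noteq> 0" "x \<noteq> 0"
    using assms pochhammer_eq_0_imp_nonpos_Int by auto
  moreover have "x * pochhammer (1 + x) n = pochhammer x n * (x + of_nat n)"
    using pochhammer_rec[of x n] pochhammer_Suc[of x n] by (simp add: add.commute)
  ultimately show ?thesis
    by (simp add: field_simps)
qed

text \<open>The weight is 1 + 2n/\<gamma>. The part with 1 is Chu-Vandermonde at (b, d). In the part
  with n, absorbing n into the binomial coefficient lowers N by one and moves the parameters to (b +
  1, d + 1). Both evaluations carry d - b = 1 + \<beta>, so they share the factor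
  \<open>pochhammer (1 + \<beta>) M\<close>.\<close>

lemma well_poised_sum:
  fixes \<beta> \<gamma> :: complex
  defines "d \<equiv> 1 + (\<gamma> + \<beta>) / 2"
  assumes d: "d \<notin> \<int>\<^sub>\<le>\<^sub>0" and \<gamma>: "\<gamma> / 2 \<notin> \<int>\<^sub>\<le>\<^sub>0"
  shows "(\<Sum>n\<le>N. of_nat (N choose n) * ((-1) ^ n *
           (pochhammer (1 + \<gamma> / 2) n / pochhammer (\<gamma> / 2) n *
            (pochhammer ((\<gamma> - \<beta>) / 2) n / pochhammer d n)))) =
         pochhammer \<beta> N / pochhammer d N * ((\<gamma> + of_nat N) / \<gamma>)"
proof (cases N)
  case 0
  thus ?thesis using \<gamma> by auto
next
  case (Suc M)
  define b where "b = (\<gamma> - \<beta>) / 2"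
  define f where "f n = (-1) ^ n * (pochhammer b n / pochhammer d n)" for n
  have d1: "d + 1 \<notin> \<int>\<^sub>\<le>\<^sub>0"
    using d plus_one_in_nonpos_Ints_imp by auto
  have nz: "pochhammer d (Suc M) \<noteq> 0" "\<gamma> \<noteq> 0"
    using d \<gamma> pochhammer_eq_0_imp_nonpos_Int by auto
  have db: "d - b = 1 + \<beta>"
    by (simp add: d_def b_def field_simps)
  have "(\<Sum>n\<le>N. of_nat (N choose n) * ((-1) ^ n *
           (pochhammer (1 + \<gamma> / 2) n / pochhammer (\<gamma> / 2) n *
            (pochhammer ((\<gamma> - \<beta>) / 2) n / pochhammer d n)))) =
        (\<Sum>n\<le>Suc M. of_nat (Suc M choose n) * f n) +
        2 / \<gamma> * (\<Sum>n\<le>Suc M. of_nat (Suc M choose n) * (of_nat n * f n))"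
    unfolding pochhammer_quotient_Suc[OF \<gamma>] Suc b_def[symmetric] sum_distrib_left sum.distrib[symmetric]
    by (intro sum.cong) (simp_all add: f_def ring_distribs mult_ac del: binomial_Suc_Suc)
  also have "(\<Sum>n\<le>Suc M. of_nat (Suc M choose n) * f n) = pochhammer (1 + \<beta>) (Suc M) / pochhammer d (Suc M)"
    unfolding f_def Chu_Vandermonde_pochhammer[OF d] db ..
  also have "(\<Sum>n\<le>Suc M. of_nat (Suc M choose n) * (of_nat n * f n)) =
      of_nat (Suc M) * (- b / d * (\<Sum>n\<le>M. of_nat (M choose n) *
        ((-1) ^ n * (pochhammer (b + 1) n / pochhammer (d + 1) n))))"
    unfolding sum_choose_weighted sum_distrib_left f_def
    by (intro sum.cong) (simp_all add: pochhammer_rec)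
  also have "\<dots> = - (of_nat (Suc M) * b * (pochhammer (1 + \<beta>) M / pochhammer d (Suc M)))"
    unfolding Chu_Vandermonde_pochhammer[OF d1] using db by (simp add: pochhammer_rec)
  also have "pochhammer (1 + \<beta>) (Suc M) / pochhammer d (Suc M) +
      2 / \<gamma> * - (of_nat (Suc M) * b * (pochhammer (1 + \<beta>) M / pochhammer d (Suc M))) =
      \<beta> * pochhammer (1 + \<beta>) M / pochhammer d (Suc M) * ((\<gamma> + of_nat (Suc M)) / \<gamma>)"
    using nz by (simp add: pochhammer_Suc[of "1 + \<beta>"] b_def field_simps del: pochhammer_Suc)
  finally show ?thesis
    using Suc by (simp add: pochhammer_rec[of \<beta>] add.commute)
qed

text \<open>The general term factors into a function of m + n, the binomial coefficient and a
  function of n, as \<open>alternating_double_series\<close> requires. The diagonal sum brings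
  \<open>pochhammer \<beta> N\<close>, which cancels the denominator parameter \<beta>, and
  (\<gamma> + N)/\<gamma>, which raises \<gamma> to \<gamma> + 1.\<close>

lemma KdF_eq_hypergeometric:
  fixes \<alpha> \<beta> \<gamma> :: complex
  defines "d \<equiv> 1 + (\<gamma> + \<beta>) / 2"
  assumes conv: "KdF_converges [\<alpha>, \<gamma>] [] [1 + \<gamma> / 2, (\<gamma> - \<beta>) / 2] [\<beta>] [] [\<gamma> / 2, d] (1/2) (-1/2)"
    and nonpos: "\<beta> \<notin> \<int>\<^sub>\<le>\<^sub>0" "\<gamma> / 2 \<notin> \<int>\<^sub>\<le>\<^sub>0" "d \<notin> \<int>\<^sub>\<le>\<^sub>0"
  shows "KdF [\<alpha>, \<gamma>] [] [1 + \<gamma> / 2, (\<gamma> - \<beta>) / 2] [\<beta>] [] [\<gamma> / 2, d] (1/2) (-1/2) =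
         (\<Sum>N. pochhammer \<alpha> N * pochhammer (\<gamma> + 1) N / (pochhammer d N * fact N * 2 ^ N))"
proof -
  \<comment> \<open>N! is written as \<open>pochhammer 1 N\<close> to make \<phi> a product of
    Pochhammer ratios, hence subexponential.\<close>
  define \<phi> where "\<phi> N = pochhammer \<alpha> N / pochhammer \<beta> N * (pochhammer \<gamma> N / pochhammer 1 N)" for N
  define \<psi> where "\<psi> n = pochhammer (1 + \<gamma> / 2) n / pochhammer (\<gamma> / 2) n *
    (pochhammer ((\<gamma> - \<beta>) / 2) n / pochhammer d n)" for n
  have p: "(\<Sum>n\<le>N. of_nat (N choose n) * ((-1) ^ n * \<psi> n)) =
      pochhammer \<beta> N / pochhammer d N * ((\<gamma> + of_nat N) * (1 / \<gamma>))" for N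
    unfolding \<psi>_def d_def using well_poised_sum[of \<gamma> \<beta> N] nonpos by (simp add: d_def)
  have term_eq: "kdf_term [\<alpha>, \<gamma>] [] [1 + \<gamma> / 2, (\<gamma> - \<beta>) / 2] [\<beta>] [] [\<gamma> / 2, d] (1/2) (-1/2) m n =
      \<phi> (m + n) * of_nat ((m + n) choose n) * (-1) ^ n * \<psi> n / 2 ^ (m + n)" for m n
  proof -
    have "(of_nat ((m + n) choose n) :: complex) = pochhammer 1 (m + n) / (fact n * fact m)"
      by (simp add: binomial_fact flip: pochhammer_fact)
    moreover have "pochhammer 1 (m + n) \<noteq> (0 :: complex)"
      by (simp flip: pochhammer_fact)
    ultimately show ?thesis
      unfolding kdf_term_def poch_list_def \<phi>_def \<psi>_def power_divide power_add by (simp add: mult_ac)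
  qed
  have "KdF [\<alpha>, \<gamma>] [] [1 + \<gamma> / 2, (\<gamma> - \<beta>) / 2] [\<beta>] [] [\<gamma> / 2, d] (1/2) (-1/2) =
      (\<Sum>N. \<phi> N * (\<Sum>n\<le>N. of_nat (N choose n) * ((-1) ^ n * \<psi> n)) / 2 ^ N)"
    unfolding KdF_def term_eq
  proof (rule alternating_double_series)
    show "subexponential \<phi>" "subexponential \<psi>"
      unfolding \<phi>_def \<psi>_def by (intro subexponential_mult subexponential_pochhammer_ratio)+
    show "subexponential (\<lambda>N. \<Sum>n\<le>N. of_nat (N choose n) * ((-1) ^ n * \<psi> n))"
      unfolding p by (intro subexponential_mult subexponential_pochhammer_ratio
          subexponential_add_of_nat subexponential_const)
    show "summable (\<lambda>m. \<Sum>n. \<phi> (m + n) * of_nat ((m + n) choose n) * (-1) ^ n * \<psi> n / 2 ^ (m + n))"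
      using conv unfolding KdF_converges_def term_eq by blast
  qed
  also have "(\<lambda>N. \<phi> N * (\<Sum>n\<le>N. of_nat (N choose n) * ((-1) ^ n * \<psi> n)) / 2 ^ N) =
      (\<lambda>N. pochhammer \<alpha> N * pochhammer (\<gamma> + 1) N / (pochhammer d N * fact N * 2 ^ N))"
  proof
    fix N
    have "pochhammer \<beta> N \<noteq> 0" "\<gamma> \<noteq> 0"
      using nonpos pochhammer_eq_0_imp_nonpos_Int by auto
    moreover have "pochhammer \<gamma> N * (\<gamma> + of_nat N) = \<gamma> * pochhammer (\<gamma> + 1) N"
      using pochhammer_rec[of \<gamma> N] pochhammer_Suc[of \<gamma> N] by simp
    ultimately show "\<phi> N * (\<Sum>n\<le>N. of_nat (N choose n) * ((-1) ^ n * \<psi> n)) / 2 ^ N =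
        pochhammer \<alpha> N * pochhammer (\<gamma> + 1) N / (pochhammer d N * fact N * 2 ^ N)"
      unfolding p \<phi>_def pochhammer_fact by (simp add: divide_simps)
  qed
  finally show ?thesis .
qed

subsection \<open>The Gauss function at \<open>1/2\<close>\<close>

text \<open>Dividing \<open>\<^sub>2F\<^sub>1(a, b; c; 1/2)\<close> by \<open>\<Gamma>(c)\<close> makes it entire in \<open>c\<close>, so that the contiguous relations, which
  shift \<open>c\<close>, hold without exceptions.\<close>

definition regF_term :: "complex \<Rightarrow> complex \<Rightarrow> complex \<Rightarrow> nat \<Rightarrow> complex" where
  "regF_term a b c N = pochhammer a N * pochhammer b N * rGamma (c + of_nat N) / (fact N * 2 ^ N)"

definition regF :: "complex \<Rightarrow> complex \<Rightarrow> complex \<Rightarrow> complex" where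
  "regF a b c = (\<Sum>N. regF_term a b c N)"

lemma rGamma_rec: "rGamma (z :: complex) = z * rGamma (z + 1)"
  by (rule rGamma_plus1[symmetric])

text \<open>Kept free of division so that it also holds where c + N = 0; this is what lets the
  recursion in \<open>regF_shift2\<close> hold for all \<open>c\<close>.\<close>

lemma regF_term_Suc:
  "2 * of_nat (Suc N) * (c + of_nat N) * regF_term a b c (Suc N) =
   (a + of_nat N) * (b + of_nat N) * regF_term a b c N"
proof -
  have "rGamma (c + of_nat N) = (c + of_nat N) * rGamma (c + of_nat (Suc N))"
    using rGamma_rec[of "c + of_nat N"] by (simp add: add_ac)
  thus ?thesis
    by (simp add: regF_term_def pochhammer_Suc divide_simps del: of_nat_Suc)
qed

lemma regF_term_bound:
  obtains K where "K \<ge> 0" "\<And>N. norm (regF_term a b c N) \<le> K * (3/4) ^ N"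
proof -
  define r where "r n = (a + of_nat n) / (c + of_nat n) * ((b + of_nat n) / (1 + of_nat n)) * (1 / 2)" for n
  have "r \<longlonglongrightarrow> 1 * 1 * (1 / 2)"
    unfolding r_def by (intro tendsto_mult tendsto_shifted_quotient tendsto_const)
  hence "(\<lambda>n. norm (r n)) \<longlonglongrightarrow> norm (1 * 1 * (1 / 2) :: complex)"
    by (rule tendsto_norm)
  hence lim: "(\<lambda>n. norm (r n)) \<longlonglongrightarrow> 1 / 2"
    by (simp add: norm_divide)
  have rec: "\<forall>\<^sub>F n in sequentially. regF_term a b c (Suc n) = r n * regF_term a b c n"
    using eventually_add_of_nat_neq_0[of c]
  proof eventually_elim
    case (elim n)
    have "regF_term a b c (Suc n) =
        (a + of_nat n) * (b + of_nat n) * regF_term a b c n / (2 * of_nat (Suc n) * (c + of_nat n))"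
      using elim regF_term_Suc[of n c a b]
      by (subst nonzero_eq_divide_eq) (simp_all add: mult.commute del: of_nat_Suc distrib_left_numeral distrib_right_numeral)
    thus ?case
      by (simp add: r_def mult_ac)
  qed
  show ?thesis
    \<comment> \<open>The term ratio tends to the argument 1/2; 3/4 leaves room below 1 for a
      subexponential factor.\<close>
    by (rule geometric_bound_of_ratio[OF rec lim, of "3/4"]) (use that in auto)
qed

lemma summable_norm_regF: "summable (\<lambda>N. norm (regF_term a b c N))"
proof -
  obtain K where K: "\<And>N. norm (regF_term a b c N) \<le> K * (3/4) ^ N"
    using regF_term_bound[of a b c] by blast
  show ?thesis
    by (rule summable_comparison_test[of _ "\<lambda>N. K * (3/4) ^ N"])
       (use K in \<open>auto intro!: summable_mult summable_geometric\<close>)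
qed

lemma regF_sums: "regF_term a b c sums regF a b c"
  unfolding regF_def using summable_norm_cancel[OF summable_norm_regF] by (rule summable_sums)

lemma subexponential_regF_tendsto_0:
  assumes "subexponential f"
  shows "(\<lambda>N. f N * regF_term a b c N) \<longlonglongrightarrow> 0"
proof -
  obtain K where K: "K \<ge> 0" "\<And>N. norm (regF_term a b c N) \<le> K * (3/4) ^ N"
    using regF_term_bound[of a b c] by blast
  \<comment> \<open>The rate 5/4 is chosen because 5/4 * 3/4 = 15/16 < 1.\<close>
  obtain L where L: "L \<ge> 0" "\<And>N. norm (f N) \<le> L * (5/4) ^ N"
    using subexponentialE[OF assms, of "5/4"] by auto
  have "norm (f N * regF_term a b c N) \<le> L * K * (15/16) ^ N" for N
  proof -
    have "norm (f N * regF_term a b c N) \<le> (L * (5/4) ^ N) * (K * (3/4) ^ N)"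
      unfolding norm_mult using K L by (intro mult_mono) auto
    also have "\<dots> = L * K * ((5/4) * (3/4)) ^ N"
      unfolding power_mult_distrib by simp
    finally show ?thesis by simp
  qed
  moreover have "(\<lambda>N. L * K * (15/16) ^ N) \<longlonglongrightarrow> 0"
    by (intro tendsto_mult_right_zero LIMSEQ_realpow_zero) auto
  ultimately show ?thesis
    by (rule Lim_null_comparison[OF always_eventually[OF allI]])
qed

section \<open>Contiguous relations and the recursion in \<open>c\<close>\<close>

text \<open>Termwise this is c + N = (c - a) + (a + N): the factor c + N comes from
  \<open>rGamma\<close>, and a + N from raising \<open>a\<close> in the Pochhammer symbol.\<close>

lemma regF_contiguous_a:
  "regF a b c = (c - a) * regF a b (c + 1) + a * regF (a + 1) b (c + 1)"
proof -
  have "(\<lambda>N. (c - a) * regF_term a b (c + 1) N + a * regF_term (a + 1) b (c + 1) N) sums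
      ((c - a) * regF a b (c + 1) + a * regF (a + 1) b (c + 1))"
    by (intro sums_add sums_mult regF_sums)
  moreover have "(c - a) * regF_term a b (c + 1) N + a * regF_term (a + 1) b (c + 1) N = regF_term a b c N" for N
  proof -
    have "a * pochhammer (a + 1) N = pochhammer a N * (a + of_nat N)"
      using pochhammer_rec[of a N] pochhammer_Suc[of a N] by simp
    moreover have "rGamma (c + of_nat N) = (c + of_nat N) * rGamma (c + 1 + of_nat N)"
      using rGamma_rec[of "c + of_nat N"] by (simp add: add_ac)
    moreover define X where "X = pochhammer b N * rGamma (c + 1 + of_nat N) / (fact N * 2 ^ N)"
    have "regF_term a b (c + 1) N = pochhammer a N * X" "regF_term (a + 1) b (c + 1) N = pochhammer (a + 1) N * X"
      by (simp_all add: regF_term_def X_def)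
    moreover have "regF_term a b c N = pochhammer a N * (c + of_nat N) * X"
      using calculation(2) by (simp add: regF_term_def X_def)
    ultimately show ?thesis
      by algebra
  qed
  ultimately show ?thesis
    using regF_sums[of a b c] sums_unique2 by auto
qed

text \<open>Lowering \<open>b\<close> changes the series by a/2 times the one with \<open>a\<close>
  and \<open>c\<close> raised, 1/2 being the argument. \<open>regF_contiguous_a\<close> then
  eliminates the raised \<open>a\<close>.\<close>

lemma regF_contiguous_b:
  "regF a (b - 1) c = (regF a b c + (c - a) * regF a b (c + 1)) / 2"
proof -
  \<comment> \<open>The terms at index 0 agree, so the difference of the series starts at index
    1.\<close>
  have "(\<lambda>N. regF_term a b c (Suc N) - regF_term a (b - 1) c (Suc N)) sums
      (regF a b c - regF a (b - 1) c)"
    using sums_diff[OF regF_sums[of a b c] regF_sums[of a "b - 1" c]]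
    by (subst sums_Suc_iff) (simp add: regF_term_def)
  moreover have "regF_term a b c (Suc N) - regF_term a (b - 1) c (Suc N) =
      a / 2 * regF_term (a + 1) b (c + 1) N" for N
  proof -
    have "pochhammer b (Suc N) - pochhammer (b - 1) (Suc N) = of_nat (Suc N) * pochhammer b N"
      by (simp add: pochhammer_Suc[of b] pochhammer_rec[of "b - 1"] algebra_simps)
    hence "regF_term a b c (Suc N) - regF_term a (b - 1) c (Suc N) =
        pochhammer a (Suc N) * (of_nat (Suc N) * pochhammer b N) * rGamma (c + of_nat (Suc N)) / (fact (Suc N) * 2 ^ Suc N)"
      unfolding regF_term_def by (simp only: flip: diff_divide_distrib left_diff_distrib right_diff_distrib)
    also have "\<dots> = a / 2 * regF_term (a + 1) b (c + 1) N"
      by (simp add: regF_term_def pochhammer_rec[of a] add_ac divide_simps del: of_nat_Suc)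
        (simp add: add_ac)
    finally show ?thesis .
  qed
  ultimately have "(\<lambda>N. a / 2 * regF_term (a + 1) b (c + 1) N) sums (regF a b c - regF a (b - 1) c)"
    by simp
  moreover have "(\<lambda>N. a / 2 * regF_term (a + 1) b (c + 1) N) sums (a / 2 * regF (a + 1) b (c + 1))"
    by (intro sums_mult regF_sums)
  ultimately have "regF a b c - regF a (b - 1) c = a / 2 * regF (a + 1) b (c + 1)"
    by (rule sums_unique2)
  hence "2 * (regF a b c - regF a (b - 1) c) = a * regF (a + 1) b (c + 1)"
    by (simp add: mult.commute)
  hence "2 * regF a (b - 1) c = regF a b c + (c - a) * regF a b (c + 1)"
    using regF_contiguous_a[of a b c] by algebra
  thus ?thesis
    by (simp add: mult.commute)
qed

text \<open>At argument 1/2 the three-term contiguous relation in \<open>c\<close> loses its middle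
  term when the upper parameters add up to 1, so \<open>c\<close> is linked to c + 2
  directly.\<close>

lemma regF_shift2:
  "regF a (1 - a) c = (c + 1 - a) * (c + a) * regF a (1 - a) (c + 2)"
proof -
  define w where "w = regF_term a (1 - a) (c + 2)"
  \<comment> \<open>The telescoping certificate; the summand \<open>0\<close> only matches the shape of \<open>subexponential_add_of_nat\<close>.\<close>
  define g where "g N = (0 + of_nat N) * (c + 1 + of_nat N) * 2 * w N" for N
  have "g \<longlonglongrightarrow> 0"
    unfolding g_def w_def
    by (intro subexponential_regF_tendsto_0 subexponential_mult subexponential_add_of_nat subexponential_const)
  hence "(\<lambda>N. g N - g (Suc N)) sums (g 0 - 0)"
    by (rule telescope_sums')
  moreover have "g N - g (Suc N) = regF_term a (1 - a) c N - (c + 1 - a) * (c + a) * w N" for N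
  proof -
    have "rGamma (c + of_nat N) = (c + of_nat N) * ((c + of_nat N + 1) * rGamma (c + 2 + of_nat N))"
      using rGamma_rec[of "c + of_nat N"] rGamma_rec[of "c + of_nat N + 1"] by (simp add: add_ac)
    hence "regF_term a (1 - a) c N = (c + of_nat N) * (c + of_nat N + 1) * w N"
      by (simp add: regF_term_def w_def)
    moreover have "g (Suc N) = (a + of_nat N) * (1 - a + of_nat N) * w N"
      using regF_term_Suc[of N "c + 2" a "1 - a"] by (simp add: g_def w_def algebra_simps)
    ultimately show ?thesis
      unfolding g_def by algebra
  qed
  moreover have "(\<lambda>N. regF_term a (1 - a) c N - (c + 1 - a) * (c + a) * w N) sums
      (regF a (1 - a) c - (c + 1 - a) * (c + a) * regF a (1 - a) (c + 2))"
    unfolding w_def by (intro sums_diff sums_mult regF_sums)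
  ultimately have "regF a (1 - a) c - (c + 1 - a) * (c + a) * regF a (1 - a) (c + 2) = g 0"
    by (metis (no_types, lifting) diff_zero sums_cong sums_unique2)
  thus ?thesis
    by (simp add: g_def)
qed

text \<open>Gauss's limit for Gamma, multiplied by \<open>rGamma z\<close>: the Pochhammer symbol in
  its denominator moves the argument to z + n + 1.\<close>

lemma rGamma_shift_asymptotic:
  assumes "(z :: complex) \<notin> \<int>\<^sub>\<le>\<^sub>0"
  shows "(\<lambda>n. fact n * exp (z * of_real (ln (of_nat n))) * rGamma (z + of_nat (Suc n))) \<longlonglongrightarrow> 1"
proof -
  have "(\<lambda>n. Gamma_series z n * rGamma z) \<longlonglongrightarrow> Gamma z * rGamma z"
    by (intro tendsto_intros)
  also have "Gamma z * rGamma z = 1"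
    using assms by (simp add: rGamma_inverse_Gamma Gamma_eq_zero_iff)
  also have "(\<lambda>n. Gamma_series z n * rGamma z) =
      (\<lambda>n. fact n * exp (z * of_real (ln (of_nat n))) * rGamma (z + of_nat (Suc n)))"
  proof
    fix n
    have "pochhammer z (Suc n) \<noteq> 0"
      using assms pochhammer_eq_0_imp_nonpos_Int by blast
    thus "Gamma_series z n * rGamma z = fact n * exp (z * of_real (ln (of_nat n))) * rGamma (z + of_nat (Suc n))"
      using pochhammer_rGamma[of z "Suc n"] by (simp add: Gamma_series_def del: of_nat_Suc)
  qed
  finally show ?thesis .
qed

lemma not_nonpos_Int_of_Re_pos: "Re z > 0 \<Longrightarrow> z \<notin> \<int>\<^sub>\<le>\<^sub>0"
  by (auto elim!: nonpos_Ints_cases)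

subsection \<open>Bailey's theorem and its generalisations\<close>

text \<open>Bailey's closed form for 2F1(a, 1 - a; c; 1/2), divided by \<Gamma>(c) to match
  \<open>regF\<close>.\<close>

definition Bailey_value :: "complex \<Rightarrow> complex \<Rightarrow> complex" where
  "Bailey_value a c = exp ((1 - c) * of_real (ln 2)) * of_real (sqrt pi) *
     rGamma ((c - a + 1) / 2) * rGamma ((c + a) / 2)"

lemma Bailey_value_shift2: "Bailey_value a c = (c + 1 - a) * (c + a) * Bailey_value a (c + 2)"
proof -
  have "exp ((1 - c) * of_real (ln 2)) = exp ((1 - (c + 2)) * of_real (ln 2) + 2 * of_real (ln 2) :: complex)"
    by (simp add: algebra_simps)
  also have "\<dots> = exp ((1 - (c + 2)) * of_real (ln 2)) * exp (2 * of_real (ln 2))"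
    by (rule exp_add)
  also have "exp (2 * of_real (ln 2) :: complex) = of_real (exp (2 * ln 2))"
    by (simp flip: exp_of_real)
  also have "exp (2 * ln 2 :: real) = 4"
    by (simp add: exp_double)
  finally have e: "exp ((1 - c) * of_real (ln 2)) = exp ((1 - (c + 2)) * of_real (ln 2)) * (4 :: complex)"
    by simp
  have r1: "rGamma ((c - a + 1) / 2) = (c - a + 1) / 2 * rGamma ((c + 2 - a + 1) / 2)"
    using rGamma_rec[of "(c - a + 1) / 2"] by (simp add: add_divide_distrib diff_divide_distrib add_ac)
  have r2: "rGamma ((c + a) / 2) = (c + a) / 2 * rGamma ((c + 2 + a) / 2)"
    using rGamma_rec[of "(c + a) / 2"] by (simp add: add_divide_distrib add_ac)
  show ?thesis
    unfolding Bailey_value_def e r1 r2 by (simp add: field_simps)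
qed

text \<open>Legendre duplication trades the power of 2 and sqrt pi for two Gamma values. The
  arguments of the \<open>Gamma\<close> factors and those of the \<open>rGamma\<close> factors then
  have the same sum c + 1/2.\<close>

lemma Gamma_times_Bailey_value:
  assumes "Re c > 0"
  shows "Gamma c * Bailey_value a c =
    Gamma (c / 2) * Gamma ((c + 1) / 2) * rGamma ((c - a + 1) / 2) * rGamma ((c + a) / 2)"
proof -
  have "c / 2 \<notin> \<int>\<^sub>\<le>\<^sub>0" "c / 2 + 1 / 2 \<notin> \<int>\<^sub>\<le>\<^sub>0"
    using assms by (auto intro!: not_nonpos_Int_of_Re_pos)
  from Gamma_legendre_duplication[OF this] show ?thesis
    by (simp add: Bailey_value_def add_divide_distrib)
qed

text \<open>Equal argument sums make the growth factors of \<open>rGamma_shift_asymptotic\<close>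
  cancel, as \<open>E\<close> records; a quotient of sequences with limit 1 remains.\<close>

lemma Bailey_value_asymptotic:
  assumes "Re c > 0" "Re (c + a) > 0" "Re (c - a + 1) > 0"
  shows "(\<lambda>n. Gamma (c + 2 * of_nat (Suc n)) * Bailey_value a (c + 2 * of_nat (Suc n))) \<longlonglongrightarrow> 1"
proof -
  define E where "E n z = fact n * exp (z * of_real (ln (of_nat n)))" for n and z :: complex
  define X where "X z n = E n z * rGamma (z + of_nat (Suc n))" for z n
  have X: "X z \<longlonglongrightarrow> 1" if "Re z > 0" for z
    unfolding X_def E_def using that by (intro rGamma_shift_asymptotic not_nonpos_Int_of_Re_pos)
  have E: "E n ((c - a + 1) / 2) * E n ((c + a) / 2) = E n (c / 2) * E n ((c + 1) / 2)" for n
  proof -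
    have "(c - a + 1) / 2 * z + (c + a) / 2 * z = c / 2 * z + (c + 1) / 2 * z" for z
      by (simp add: field_simps)
    moreover have "E n x * E n y = fact n * fact n *
        exp (x * of_real (ln (of_nat n)) + y * of_real (ln (of_nat n)))" for x y
      by (simp add: E_def exp_add mult_ac)
    ultimately show ?thesis
      by simp
  qed
  have "(\<lambda>n. X ((c - a + 1) / 2) n * X ((c + a) / 2) n / (X (c / 2) n * X ((c + 1) / 2) n)) \<longlonglongrightarrow> 1 * 1 / (1 * 1)"
    using assms by (intro tendsto_intros X) auto
  also have "(\<lambda>n. X ((c - a + 1) / 2) n * X ((c + a) / 2) n / (X (c / 2) n * X ((c + 1) / 2) n)) =
      (\<lambda>n. Gamma (c + 2 * of_nat (Suc n)) * Bailey_value a (c + 2 * of_nat (Suc n)))"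
  proof
    fix n
    have nz: "E n (c / 2) * E n ((c + 1) / 2) \<noteq> 0"
      by (simp add: E_def)
    have "X ((c - a + 1) / 2) n * X ((c + a) / 2) n / (X (c / 2) n * X ((c + 1) / 2) n) =
        (E n ((c - a + 1) / 2) * E n ((c + a) / 2)) *
        (rGamma ((c - a + 1) / 2 + of_nat (Suc n)) * rGamma ((c + a) / 2 + of_nat (Suc n))) /
        ((E n (c / 2) * E n ((c + 1) / 2)) *
        (rGamma (c / 2 + of_nat (Suc n)) * rGamma ((c + 1) / 2 + of_nat (Suc n))))"
      unfolding X_def by (simp only: mult_ac)
    also have "\<dots> = Gamma (c / 2 + of_nat (Suc n)) * Gamma ((c + 1) / 2 + of_nat (Suc n)) *
        rGamma ((c - a + 1) / 2 + of_nat (Suc n)) * rGamma ((c + a) / 2 + of_nat (Suc n))"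
      unfolding E using nz by (simp add: rGamma_inverse_Gamma divide_simps del: of_nat_Suc)
    also have "\<dots> = Gamma (c + 2 * of_nat (Suc n)) * Bailey_value a (c + 2 * of_nat (Suc n))"
    proof -
      have "Re (c + 2 * of_nat (Suc n)) > 0" using assms by (simp add: add_pos_nonneg)
      moreover have "c / 2 + k = (c + 2 * k) / 2" "(c + 1) / 2 + k = (c + 2 * k + 1) / 2"
        "(c - a + 1) / 2 + k = (c + 2 * k - a + 1) / 2" "(c + a) / 2 + k = (c + 2 * k + a) / 2" for k
        by (simp_all add: field_simps)
      ultimately show ?thesis
        by (simp only: Gamma_times_Bailey_value)
    qed
    finally show "X ((c - a + 1) / 2) n * X ((c + a) / 2) n / (X (c / 2) n * X ((c + 1) / 2) n) =
      Gamma (c + 2 * of_nat (Suc n)) * Bailey_value a (c + 2 * of_nat (Suc n))" .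
  qed
  finally show ?thesis by simp
qed

section \<open>Asymptotics of the Gauss series for large \<open>c\<close>\<close>

lemma Gamma_times_regF_term:
  assumes "c \<notin> \<int>\<^sub>\<le>\<^sub>0"
  shows "Gamma c * regF_term a b c N = pochhammer a N * pochhammer b N / (pochhammer c N * fact N * 2 ^ N)"
proof -
  have "pochhammer c N \<noteq> 0" "Gamma c \<noteq> 0"
    using assms pochhammer_eq_0_imp_nonpos_Int Gamma_eq_zero_iff by auto
  moreover have "rGamma c = pochhammer c N * rGamma (c + of_nat N)"
    by (rule pochhammer_rGamma)
  ultimately have "Gamma c * rGamma (c + of_nat N) = 1 / pochhammer c N"
    by (simp add: rGamma_inverse_Gamma[of c] field_simps)
  thus ?thesis
    by (simp add: regF_term_def mult.left_commute[of "Gamma c"] mult.assoc)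
qed

text \<open>The factor c contributes at least Re c, and each later factor c + k at least k.\<close>

lemma norm_pochhammer_Suc_ge:
  fixes c :: complex
  assumes "Re c \<ge> 0"
  shows "norm (pochhammer c (Suc N)) \<ge> Re c * fact N"
proof (induction N)
  case 0
  show ?case using complex_Re_le_cmod by simp
next
  case (Suc N)
  have "of_nat (Suc N) \<le> Re (c + of_nat (Suc N))" using assms by simp
  also have "\<dots> \<le> norm (c + of_nat (Suc N))" by (rule complex_Re_le_cmod)
  finally have "Re c * fact N * of_nat (Suc N) \<le> norm (pochhammer c (Suc N)) * norm (c + of_nat (Suc N))"
    using Suc by (intro mult_mono) auto
  thus ?case
    by (subst pochhammer_Suc) (simp add: norm_mult mult_ac)
qed

text \<open>The term at index 0 is 1. In the others, \<open>pochhammer c (Suc N)\<close> is bounded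
  below by Re c * N!, and replacing it by N! gives exactly the regularised series at c = 0, since
  \<open>rGamma\<close> at N + 1 is 1/N!. That series is a majorant independent of
  \<open>c\<close>.\<close>

lemma norm_Gamma_times_regF_minus_1_le:
  assumes c: "Re c > 0"
  shows "norm (Gamma c * regF a b c - 1) \<le> (\<Sum>N. norm (regF_term a b 0 (Suc N))) / Re c"
proof -
  have cn: "c \<notin> \<int>\<^sub>\<le>\<^sub>0" using c by (rule not_nonpos_Int_of_Re_pos)
  have s: "(\<lambda>N. Gamma c * regF_term a b c N) sums (Gamma c * regF a b c)"
    by (intro sums_mult regF_sums)
  hence s': "(\<lambda>N. Gamma c * regF_term a b c (Suc N)) sums (Gamma c * regF a b c - 1)"
    by (subst sums_Suc_iff) (simp add: Gamma_times_regF_term[OF cn])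
  have "norm (Gamma c * regF_term a b c (Suc N)) \<le> norm (regF_term a b 0 (Suc N)) / Re c" for N
  proof -
    have "rGamma (of_nat (Suc N) :: complex) = 1 / fact N"
      using Gamma_fact[of N, where ?'a = complex] by (simp add: rGamma_inverse_Gamma divide_inverse add.commute)
    hence right: "norm (regF_term a b 0 (Suc N)) / Re c =
        norm (pochhammer a (Suc N) * pochhammer b (Suc N)) / (fact (Suc N) * 2 ^ Suc N) / (Re c * fact N)"
      using c by (simp add: regF_term_def norm_mult norm_divide norm_power del: of_nat_Suc)
    have left: "norm (Gamma c * regF_term a b c (Suc N)) =
        norm (pochhammer a (Suc N) * pochhammer b (Suc N)) / (fact (Suc N) * 2 ^ Suc N) / norm (pochhammer c (Suc N))"
      unfolding Gamma_times_regF_term[OF cn] by (simp add: norm_mult norm_divide norm_power mult_ac del: of_nat_Suc fact_Suc)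
    have mono: "x / norm (pochhammer c (Suc N)) \<le> x / (Re c * fact N)" if "x \<ge> 0" for x
    proof (rule divide_left_mono[OF _ that])
      show le: "Re c * fact N \<le> norm (pochhammer c (Suc N))"
        using norm_pochhammer_Suc_ge[of c N] c by simp
      have "Re c * fact N > 0"
        using c by simp
      with le show "norm (pochhammer c (Suc N)) * (Re c * fact N) > 0"
        by (metis mult_pos_pos order_less_le_trans)
    qed
    show ?thesis
      unfolding left right by (rule mono) simp
  qed
  moreover have "(\<lambda>N. norm (regF_term a b 0 (Suc N)) / Re c) sums ((\<Sum>N. norm (regF_term a b 0 (Suc N))) / Re c)"
    using summable_norm_regF[of a b 0] by (intro sums_divide summable_sums) (subst summable_Suc_iff)
  ultimately show ?thesis
    using s' by (metis (no_types, lifting) norm_suminf_le sums_iff)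
qed

lemma regF_asymptotic:
  assumes "Re c > 0"
  shows "(\<lambda>n. Gamma (c + 2 * of_nat (Suc n)) * regF a b (c + 2 * of_nat (Suc n))) \<longlonglongrightarrow> 1"
proof -
  define H where "H = (\<Sum>N. norm (regF_term a b 0 (Suc N)))"
  have "filterlim (\<lambda>n. Re c + 2 * real (Suc n)) at_top sequentially"
    by (intro filterlim_tendsto_add_at_top[OF tendsto_const] filterlim_compose[OF filterlim_real_sequentially]
        filterlim_tendsto_pos_mult_at_top[OF tendsto_const] filterlim_Suc) auto
  hence "(\<lambda>n. H / (Re c + 2 * real (Suc n))) \<longlonglongrightarrow> 0"
    by (intro tendsto_divide_0[OF tendsto_const] filterlim_at_top_imp_at_infinity)
  moreover have "norm (Gamma (c + 2 * of_nat (Suc n)) * regF a b (c + 2 * of_nat (Suc n)) - 1) \<le>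
      H / (Re c + 2 * real (Suc n))" for n
    using norm_Gamma_times_regF_minus_1_le[of "c + 2 * of_nat (Suc n)" a b] assms
    by (simp add: H_def add_pos_nonneg)
  ultimately have "(\<lambda>n. Gamma (c + 2 * of_nat (Suc n)) * regF a b (c + 2 * of_nat (Suc n)) - 1) \<longlonglongrightarrow> 0"
    by (rule Lim_null_comparison[OF always_eventually[OF allI], rotated])
  thus ?thesis
    using Lim_null by blast
qed

theorem Bailey_regF: "regF a (1 - a) c = Bailey_value a c"
proof -
  \<comment> \<open>Both sides obey the same recursion in \<open>c\<close>; cross-multiplying avoids dividing by its coefficients.\<close>
  have cross: "regF a (1 - a) c * Bailey_value a (c + 2 * of_nat n) =
      Bailey_value a c * regF a (1 - a) (c + 2 * of_nat n)" for c n
  proof (induction n arbitrary: c)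
    case (Suc n)
    have *: "c + 2 * of_nat (Suc n) = (c + 2) + 2 * of_nat n" by simp
    show ?case
      unfolding * regF_shift2[of a c] Bailey_value_shift2[of a c] using Suc[of "c + 2"] by (simp add: mult_ac)
  qed simp
  \<comment> \<open>Multiplying the cross relation by Gamma at the shifted point normalises both
    shifted factors to limit 1.\<close>
  have right: "regF a (1 - a) c = Bailey_value a c"
    if "Re c > 0" "Re (c + a) > 0" "Re (c - a + 1) > 0" for c
  proof -
    have "regF a (1 - a) c * (Gamma (c + 2 * of_nat (Suc n)) * Bailey_value a (c + 2 * of_nat (Suc n))) =
        Bailey_value a c * (Gamma (c + 2 * of_nat (Suc n)) * regF a (1 - a) (c + 2 * of_nat (Suc n)))" for n
      using cross[of c "Suc n"] by (metis mult.left_commute)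
    moreover have "(\<lambda>n. Bailey_value a c * (Gamma (c + 2 * of_nat (Suc n)) * regF a (1 - a) (c + 2 * of_nat (Suc n))))
        \<longlonglongrightarrow> Bailey_value a c * 1"
      using that by (intro tendsto_intros regF_asymptotic)
    ultimately have "(\<lambda>n. regF a (1 - a) c *
        (Gamma (c + 2 * of_nat (Suc n)) * Bailey_value a (c + 2 * of_nat (Suc n)))) \<longlonglongrightarrow> Bailey_value a c * 1"
      by (simp only:)
    moreover have "(\<lambda>n. regF a (1 - a) c *
        (Gamma (c + 2 * of_nat (Suc n)) * Bailey_value a (c + 2 * of_nat (Suc n)))) \<longlonglongrightarrow> regF a (1 - a) c * 1"
      using that by (intro tendsto_intros Bailey_value_asymptotic)
    ultimately have "Bailey_value a c * 1 = regF a (1 - a) c * 1"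
      by (rule LIMSEQ_unique)
    thus ?thesis
      by simp
  qed
  \<comment> \<open>The recursion expresses the value at c through the one at c + 2, so equality far
    to the right descends to every c without division.\<close>
  have down: "regF a (1 - a) (c + 2 * of_nat n) = Bailey_value a (c + 2 * of_nat n) \<Longrightarrow>
      regF a (1 - a) c = Bailey_value a c" for c n
  proof (induction n arbitrary: c)
    case (Suc n)
    have *: "c + 2 * of_nat (Suc n) = (c + 2) + 2 * of_nat n" by simp
    show ?case
      unfolding regF_shift2[of a c] Bailey_value_shift2[of a c] using Suc.IH[of "c + 2"] Suc.prems[unfolded *] by simp
  qed simp
  obtain n where n: "real n > \<bar>Re c\<bar> + \<bar>Re a\<bar>"
    using reals_Archimedean2 by blast
  show ?thesis
    by (rule down[of _ n], rule right) (use n in auto)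
qed

section \<open>Closed forms with upper parameters adding up to 1 - i or 1 + i\<close>

text \<open>Duplication at (c - a)/2 rewrites Bailey's value into the shape of the sums over r, of
  which this is the case i = 0.\<close>

lemma regF_half_base:
  assumes "c - a \<notin> \<int>\<^sub>\<le>\<^sub>0"
  shows "regF a (1 - a) c = 2 powr (- a) * rGamma (c - a) * (Gamma ((c - a) / 2) * rGamma ((c + a) / 2))"
proof -
  have half: "(c - a) / 2 \<notin> \<int>\<^sub>\<le>\<^sub>0" "(c - a) / 2 + 1 / 2 \<notin> \<int>\<^sub>\<le>\<^sub>0"
  proof -
    show "(c - a) / 2 \<notin> \<int>\<^sub>\<le>\<^sub>0"
    proof
      assume "(c - a) / 2 \<in> \<int>\<^sub>\<le>\<^sub>0"
      then obtain n where "(c - a) / 2 = - of_nat n" by (elim nonpos_Ints_cases')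
      hence "c - a = - of_nat (2 * n)" by (simp add: field_simps)
      thus False using assms by (metis minus_of_nat_in_nonpos_Ints)
    qed
    show "(c - a) / 2 + 1 / 2 \<notin> \<int>\<^sub>\<le>\<^sub>0"
    proof
      assume "(c - a) / 2 + 1 / 2 \<in> \<int>\<^sub>\<le>\<^sub>0"
      then obtain n where "(c - a) / 2 + 1 / 2 = - of_nat n" by (elim nonpos_Ints_cases')
      hence "c - a = - of_nat (2 * n + 1)" by (simp add: field_simps)
      thus False using assms by (metis minus_of_nat_in_nonpos_Ints)
    qed
  qed
  have two: "2 * ((c - a) / 2) = c - a"
    by simp
  have nz: "Gamma (c - a) \<noteq> 0" "Gamma ((c - a) / 2 + 1 / 2) \<noteq> 0"
    using assms half by (simp_all add: Gamma_eq_zero_iff)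
  have ex: "2 powr (- a) * exp ((1 - (c - a)) * of_real (ln 2)) = (exp ((1 - c) * of_real (ln 2)) :: complex)"
    by (simp add: powr_def algebra_simps Ln_of_real[of 2, simplified] flip: exp_add)
  have "Gamma ((c - a) / 2) * Gamma ((c - a) / 2 + 1 / 2) =
      exp ((1 - (c - a)) * of_real (ln 2)) * of_real (sqrt pi) * Gamma (c - a)"
    using Gamma_legendre_duplication[OF half] unfolding two .
  hence "rGamma (c - a) * Gamma ((c - a) / 2) =
      exp ((1 - (c - a)) * of_real (ln 2)) * of_real (sqrt pi) * rGamma ((c - a) / 2 + 1 / 2)"
    using nz by (simp add: rGamma_inverse_Gamma divide_simps)
  moreover have "(c - a) / 2 + 1 / 2 = (c - a + 1) / 2"
    by (simp add: add_divide_distrib)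
  ultimately show ?thesis
    unfolding Bailey_regF Bailey_value_def ex[symmetric] by (simp add: mult_ac)
qed

text \<open>Lowering the second parameter combines the values at c and c + 1. Passing to c + 1
  shifts r by one in the Gamma quotients, so Pascal's rule merges the two sums; the coefficient c -
  a is absorbed by \<open>rGamma (c + 1 - a)\<close>.\<close>

lemma regF_half_minus:
  assumes "c - a \<notin> \<int>\<^sub>\<le>\<^sub>0"
  shows "regF a (1 - a - of_nat i) c = 2 powr (- of_nat i - a) * rGamma (c - a) *
    (\<Sum>r\<le>i. of_nat (i choose r) * (Gamma ((c - a + of_nat r) / 2) * rGamma ((c + a + of_nat r) / 2)))"
  using assms
proof (induction i arbitrary: c)
  case 0
  thus ?case by (simp add: regF_half_base)
next
  case (Suc i)
  define G where "G c r = Gamma ((c - a + of_nat r) / 2) * rGamma ((c + a + of_nat r) / 2)" for c r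
  have G: "G (c + 1) r = G c (Suc r)" for r
    by (simp add: G_def add_ac algebra_simps)
  have c1: "c + 1 - a \<notin> \<int>\<^sub>\<le>\<^sub>0"
    using Suc.prems plus_one_in_nonpos_Ints_imp[of "c - a"] by (auto simp: algebra_simps)
  have rG: "(c - a) * rGamma (c + 1 - a) = rGamma (c - a)"
    using rGamma_plus1[of "c - a"] by (simp add: algebra_simps)
  have pw: "2 powr (- of_nat (Suc i) - a) = 2 powr (- of_nat i - a) / (2 :: complex)"
  proof -
    have "- of_nat (Suc i) - a = (- of_nat i - a) - 1" by simp
    thus ?thesis by (simp only: powr_diff) simp
  qed
  have collect: "(A * R * S + e * (A * R' * T)) / 2 = A / 2 * R * (S + T)" if "e * R' = R"
    for A R S e R' T :: complex
    by (simp add: that[symmetric] algebra_simps add_divide_distrib)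
  have "regF a (1 - a - of_nat (Suc i)) c =
      (regF a (1 - a - of_nat i) c + (c - a) * regF a (1 - a - of_nat i) (c + 1)) / 2"
    using regF_contiguous_b[of a "1 - a - of_nat i" c] by (simp add: algebra_simps)
  also have "\<dots> = 2 powr (- of_nat i - a) / 2 * rGamma (c - a) *
      ((\<Sum>r\<le>i. of_nat (i choose r) * G c r) + (\<Sum>r\<le>i. of_nat (i choose r) * G c (Suc r)))"
    unfolding Suc.IH[OF Suc.prems] Suc.IH[OF c1] G_def[symmetric] G using rG by (rule collect)
  also have "\<dots> = 2 powr (- of_nat i - a) / 2 * rGamma (c - a) *
      (\<Sum>r\<le>Suc i. of_nat (Suc i choose r) * G c r)"
    unfolding sum_choose_Suc distrib_left sum.distrib ..
  finally show ?case
    unfolding pw G_def .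
qed

text \<open>The second parameter stays fixed while \<open>a\<close> is lowered, since 1 - a + Suc i
  = 1 - (a - 1) + i. Solving \<open>regF_contiguous_a\<close> for the raised \<open>a\<close>
  combines the values for a - 1 at c - 1 and c. The latter enters with a minus sign and r shifted by
  one, which produces (-1)^r.\<close>

lemma regF_half_plus:
  assumes "c - a \<notin> \<int>\<^sub>\<le>\<^sub>0" "a - of_nat i \<notin> \<int>\<^sub>\<le>\<^sub>0"
  shows "regF a (1 - a + of_nat i) c = 2 powr (of_nat i - a) * Gamma (a - of_nat i) * rGamma a * rGamma (c - a) *
    (\<Sum>r\<le>i. of_nat (i choose r) * ((-1) ^ r *
      (Gamma ((c - a + of_nat r) / 2) * rGamma ((c + a + of_nat r) / 2 - of_nat i))))"
  using assms
proof (induction i arbitrary: a c)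
  case 0
  hence "Gamma a * rGamma a = 1"
    by (simp add: rGamma_inverse_Gamma Gamma_eq_zero_iff)
  thus ?case using 0 by (simp add: regF_half_base)
next
  case (Suc i)
  define G where "G r = (-1) ^ r * (Gamma ((c - a + of_nat r) / 2) * rGamma ((c + a + of_nat r) / 2 - of_nat (Suc i)))" for r
  have a: "a - 1 - of_nat i \<notin> \<int>\<^sub>\<le>\<^sub>0"
    using Suc.prems(2) by (simp add: algebra_simps)
  \<comment> \<open>Needed to solve the contiguous relation for \<open>regF a\<close>; a = 1 would
    make a - Suc i a non-positive integer.\<close>
  have a1: "a - 1 \<noteq> 0"
  proof
    assume "a - 1 = 0"
    hence "a - 1 - of_nat i = - of_nat i" by simp
    thus False using a by (metis minus_of_nat_in_nonpos_Ints)
  qed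
  have c: "(c - 1) - (a - 1) \<notin> \<int>\<^sub>\<le>\<^sub>0" "c - (a - 1) \<notin> \<int>\<^sub>\<le>\<^sub>0"
    using Suc.prems(1) plus_one_in_nonpos_Ints_imp[of "c - a"] by (auto simp: algebra_simps)
  define P where "P = 2 powr (of_nat i - (a - 1)) * Gamma (a - 1 - of_nat i)"
  have rG: "rGamma (a - 1) = (a - 1) * rGamma a" "(c - a) * rGamma (c - (a - 1)) = rGamma (c - a)"
    using rGamma_plus1[of "a - 1"] rGamma_plus1[of "c - a"] by (simp_all add: algebra_simps)
  have F1: "regF (a - 1) (1 - a + of_nat (Suc i)) (c - 1) =
      P * rGamma (a - 1) * rGamma (c - a) * (\<Sum>r\<le>i. of_nat (i choose r) * G r)"
  proof -
    have "(c - 1 - (a - 1) + of_nat r) / 2 = (c - a + of_nat r) / 2"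
      "(c - 1 + (a - 1) + of_nat r) / 2 - of_nat i = (c + a + of_nat r) / 2 - of_nat (Suc i)" for r
      by (simp_all add: field_simps)
    moreover have "1 - (a - 1) + of_nat i = 1 - a + of_nat (Suc i)" "c - 1 - (a - 1) = c - a"
      by simp_all
    ultimately show ?thesis
      using Suc.IH[OF c(1) a] by (simp only: P_def G_def)
  qed
  have F2: "regF (a - 1) (1 - a + of_nat (Suc i)) c =
      - P * rGamma (a - 1) * rGamma (c - (a - 1)) * (\<Sum>r\<le>i. of_nat (i choose r) * G (Suc r))"
  proof -
    have "(c - (a - 1) + of_nat r) / 2 = (c - a + of_nat (Suc r)) / 2"
      "(c + (a - 1) + of_nat r) / 2 - of_nat i = (c + a + of_nat (Suc r)) / 2 - of_nat (Suc i)" for r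
      by (simp_all add: field_simps)
    moreover have "1 - (a - 1) + of_nat i = 1 - a + of_nat (Suc i)"
      by simp
    ultimately have "regF (a - 1) (1 - a + of_nat (Suc i)) c = P * rGamma (a - 1) * rGamma (c - (a - 1)) *
        (\<Sum>r\<le>i. of_nat (i choose r) * ((-1) ^ r * (Gamma ((c - a + of_nat (Suc r)) / 2) *
          rGamma ((c + a + of_nat (Suc r)) / 2 - of_nat (Suc i)))))"
      using Suc.IH[OF c(2) a] by (simp only: P_def)
    also have "\<dots> = P * rGamma (a - 1) * rGamma (c - (a - 1)) * (\<Sum>r\<le>i. - (of_nat (i choose r) * G (Suc r)))"
      unfolding G_def by simp
    finally show ?thesis
      by (simp add: sum_negf)
  qed
  have "(a - 1) * regF a (1 - a + of_nat (Suc i)) c =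
      regF (a - 1) (1 - a + of_nat (Suc i)) (c - 1) - (c - a) * regF (a - 1) (1 - a + of_nat (Suc i)) c"
    using regF_contiguous_a[of "a - 1" "1 - a + of_nat (Suc i)" "c - 1"] by simp
  also have "\<dots> = (a - 1) * (P * rGamma a * rGamma (c - a) *
      ((\<Sum>r\<le>i. of_nat (i choose r) * G r) + (\<Sum>r\<le>i. of_nat (i choose r) * G (Suc r))))"
    unfolding F1 F2 rG(1) rG(2)[symmetric] by (simp add: algebra_simps)
  also have "\<dots> = (a - 1) * (P * rGamma a * rGamma (c - a) * (\<Sum>r\<le>Suc i. of_nat (Suc i choose r) * G r))"
    unfolding sum_choose_Suc distrib_left sum.distrib ..
  finally have "regF a (1 - a + of_nat (Suc i)) c =
      P * rGamma a * rGamma (c - a) * (\<Sum>r\<le>Suc i. of_nat (Suc i choose r) * G r)"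
    using a1 by (metis mult_left_cancel)
  moreover have "P = 2 powr (of_nat (Suc i) - a) * Gamma (a - of_nat (Suc i))"
    by (simp add: P_def algebra_simps)
  ultimately show ?case
    unfolding G_def by simp
qed

section \<open>Evaluation of the two Kampe de Feriet functions\<close>

lemma KdF_eq_Gamma_regF:
  fixes \<alpha> \<beta> \<gamma> :: complex
  defines "d \<equiv> 1 + (\<gamma> + \<beta>) / 2"
  assumes "KdF_converges [\<alpha>, \<gamma>] [] [1 + \<gamma> / 2, (\<gamma> - \<beta>) / 2] [\<beta>] [] [\<gamma> / 2, d] (1/2) (-1/2)"
    and "\<beta> \<notin> \<int>\<^sub>\<le>\<^sub>0" "\<gamma> / 2 \<notin> \<int>\<^sub>\<le>\<^sub>0" and d: "d \<notin> \<int>\<^sub>\<le>\<^sub>0"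
  shows "KdF [\<alpha>, \<gamma>] [] [1 + \<gamma> / 2, (\<gamma> - \<beta>) / 2] [\<beta>] [] [\<gamma> / 2, d] (1/2) (-1/2) =
         Gamma d * regF \<alpha> (\<gamma> + 1) d"
proof -
  have "(\<lambda>N. Gamma d * regF_term \<alpha> (\<gamma> + 1) d N) sums (Gamma d * regF \<alpha> (\<gamma> + 1) d)"
    by (intro sums_mult regF_sums)
  thus ?thesis
    unfolding Gamma_times_regF_term[OF d]
    using KdF_eq_hypergeometric[of \<alpha> \<gamma> \<beta>] assms by (simp add: sums_iff d_def)
qed

theorem theorem14:
  fixes i :: nat and \<alpha> \<beta> :: complex
  shows
  "(KdF_converges [\<alpha>, of_nat i - \<alpha>] [] [1 - \<alpha>/2 + of_nat i/2, (of_nat i - \<alpha> - \<beta>)/2]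
                  [\<beta>] [] [- \<alpha>/2 + of_nat i/2, 1 + (of_nat i - \<alpha> + \<beta>)/2] (1/2) (-1/2) \<and>
    \<beta> \<notin> \<int>\<^sub>\<le>\<^sub>0 \<and> - \<alpha>/2 + of_nat i/2 \<notin> \<int>\<^sub>\<le>\<^sub>0 \<and> 1 + (of_nat i - \<alpha> + \<beta>)/2 \<notin> \<int>\<^sub>\<le>\<^sub>0 \<and>
    \<alpha> - of_nat i \<notin> \<int>\<^sub>\<le>\<^sub>0 \<and> \<alpha> \<notin> \<int>\<^sub>\<le>\<^sub>0 \<and>
    1 + (\<beta> - \<alpha> + of_nat i)/2 \<notin> \<int>\<^sub>\<le>\<^sub>0 \<and> 1 + (\<beta> - 3*\<alpha> + of_nat i)/2 \<notin> \<int>\<^sub>\<le>\<^sub>0 \<and>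
    (\<forall>r\<le>i. (\<beta> - 3*\<alpha> + of_nat i)/4 + (of_nat r + 1)/2 \<notin> \<int>\<^sub>\<le>\<^sub>0 \<and>
             (\<beta> + \<alpha> - 3 * of_nat i)/4 + (of_nat r + 1)/2 \<notin> \<int>\<^sub>\<le>\<^sub>0)
   \<longrightarrow>
    KdF [\<alpha>, of_nat i - \<alpha>] [] [1 - \<alpha>/2 + of_nat i/2, (of_nat i - \<alpha> - \<beta>)/2]
        [\<beta>] [] [- \<alpha>/2 + of_nat i/2, 1 + (of_nat i - \<alpha> + \<beta>)/2] (1/2) (-1/2)
    = (2 powr (of_nat i - \<alpha>) * Gamma (\<alpha> - of_nat i) * Gamma (1 + (\<beta> - \<alpha> + of_nat i)/2)) /
      (Gamma \<alpha> * Gamma (1 + (\<beta> - 3*\<alpha> + of_nat i)/2)) *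
      (\<Sum>r=0..i. (-1)^r * of_nat (i choose r) *
         Gamma ((\<beta> - 3*\<alpha> + of_nat i)/4 + (of_nat r + 1)/2) /
         Gamma ((\<beta> + \<alpha> - 3 * of_nat i)/4 + (of_nat r + 1)/2)))
  \<and>
   (KdF_converges [\<alpha>, - \<alpha> - of_nat i] [] [1 - \<alpha>/2 - of_nat i/2, (- of_nat i - \<alpha> - \<beta>)/2]
                  [\<beta>] [] [- \<alpha>/2 - of_nat i/2, 1 + (\<beta> - \<alpha> - of_nat i)/2] (1/2) (-1/2) \<and>
    \<beta> \<notin> \<int>\<^sub>\<le>\<^sub>0 \<and> - \<alpha>/2 - of_nat i/2 \<notin> \<int>\<^sub>\<le>\<^sub>0 \<and> 1 + (\<beta> - \<alpha> - of_nat i)/2 \<notin> \<int>\<^sub>\<le>\<^sub>0 \<and>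
    1 + (\<beta> - 3*\<alpha> - of_nat i)/2 \<notin> \<int>\<^sub>\<le>\<^sub>0 \<and>
    (\<forall>r\<le>i. (\<beta> - 3*\<alpha> - of_nat i)/4 + (of_nat r + 1)/2 \<notin> \<int>\<^sub>\<le>\<^sub>0 \<and>
             (\<beta> + \<alpha> - of_nat i)/4 + (of_nat r + 1)/2 \<notin> \<int>\<^sub>\<le>\<^sub>0)
   \<longrightarrow>
    KdF [\<alpha>, - \<alpha> - of_nat i] [] [1 - \<alpha>/2 - of_nat i/2, (- of_nat i - \<alpha> - \<beta>)/2]
        [\<beta>] [] [- \<alpha>/2 - of_nat i/2, 1 + (\<beta> - \<alpha> - of_nat i)/2] (1/2) (-1/2)
    = (2 powr (- of_nat i - \<alpha>) * Gamma (1 + (\<beta> - \<alpha> - of_nat i)/2)) /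
      Gamma (1 + (\<beta> - 3*\<alpha> - of_nat i)/2) *
      (\<Sum>r=0..i. of_nat (i choose r) *
         Gamma ((\<beta> - 3*\<alpha> - of_nat i)/4 + (of_nat r + 1)/2) /
         Gamma ((\<beta> + \<alpha> - of_nat i)/4 + (of_nat r + 1)/2)))"
proof (intro conjI impI; elim conjE)
  define \<gamma> where "\<gamma> = of_nat i - \<alpha>"
  define d where "d = 1 + (\<gamma> + \<beta>) / 2"
  assume conv: "KdF_converges [\<alpha>, of_nat i - \<alpha>] [] [1 - \<alpha>/2 + of_nat i/2, (of_nat i - \<alpha> - \<beta>)/2]
                  [\<beta>] [] [- \<alpha>/2 + of_nat i/2, 1 + (of_nat i - \<alpha> + \<beta>)/2] (1/2) (-1/2)"
    and nonpos: "\<beta> \<notin> \<int>\<^sub>\<le>\<^sub>0" "- \<alpha>/2 + of_nat i/2 \<notin> \<int>\<^sub>\<le>\<^sub>0" "1 + (of_nat i - \<alpha> + \<beta>)/2 \<notin> \<int>\<^sub>\<le>\<^sub>0"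
      "\<alpha> - of_nat i \<notin> \<int>\<^sub>\<le>\<^sub>0" "1 + (\<beta> - 3*\<alpha> + of_nat i)/2 \<notin> \<int>\<^sub>\<le>\<^sub>0"
  \<comment> \<open>In terms of \<gamma> and \<open>d\<close>, the Gamma value in the prefactor's
    denominator has argument d - \<alpha>, so its finiteness is the first hypothesis of
    \<open>regF_half_plus\<close>.\<close>
  have params: "1 - \<alpha>/2 + of_nat i/2 = 1 + \<gamma> / 2" "- \<alpha>/2 + of_nat i/2 = \<gamma> / 2"
    "1 + (of_nat i - \<alpha> + \<beta>)/2 = d" "1 + (\<beta> - \<alpha> + of_nat i)/2 = d" "1 + (\<beta> - 3*\<alpha> + of_nat i)/2 = d - \<alpha>"
    "(of_nat i - \<alpha> - \<beta>)/2 = (\<gamma> - \<beta>) / 2"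
    by (simp_all add: \<gamma>_def d_def field_simps)
  have args: "(\<beta> - 3*\<alpha> + of_nat i)/4 + (of_nat r + 1)/2 = (d - \<alpha> + of_nat r) / 2"
    "(\<beta> + \<alpha> - 3 * of_nat i)/4 + (of_nat r + 1)/2 = (d + \<alpha> + of_nat r) / 2 - of_nat i" for r
    by (simp_all add: \<gamma>_def d_def field_simps)
  have main: "KdF [\<alpha>, \<gamma>] [] [1 + \<gamma> / 2, (\<gamma> - \<beta>) / 2] [\<beta>] [] [\<gamma> / 2, d] (1/2) (-1/2) =
      Gamma d * regF \<alpha> (\<gamma> + 1) d"
    using KdF_eq_Gamma_regF[of \<alpha> \<gamma> \<beta>] conv nonpos unfolding params \<gamma>_def[symmetric] d_def[symmetric] by blast
  have \<gamma>1: "1 - \<alpha> + of_nat i = \<gamma> + 1"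
    by (simp add: \<gamma>_def)
  have "KdF [\<alpha>, of_nat i - \<alpha>] [] [1 - \<alpha>/2 + of_nat i/2, (of_nat i - \<alpha> - \<beta>)/2]
        [\<beta>] [] [- \<alpha>/2 + of_nat i/2, 1 + (of_nat i - \<alpha> + \<beta>)/2] (1/2) (-1/2) =
      Gamma d * regF \<alpha> (1 - \<alpha> + of_nat i) d"
    unfolding params \<gamma>_def[symmetric] \<gamma>1 d_def[symmetric] by (rule main)
  thus "KdF [\<alpha>, of_nat i - \<alpha>] [] [1 - \<alpha>/2 + of_nat i/2, (of_nat i - \<alpha> - \<beta>)/2]
        [\<beta>] [] [- \<alpha>/2 + of_nat i/2, 1 + (of_nat i - \<alpha> + \<beta>)/2] (1/2) (-1/2)
    = (2 powr (of_nat i - \<alpha>) * Gamma (\<alpha> - of_nat i) * Gamma (1 + (\<beta> - \<alpha> + of_nat i)/2)) /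
      (Gamma \<alpha> * Gamma (1 + (\<beta> - 3*\<alpha> + of_nat i)/2)) *
      (\<Sum>r=0..i. (-1)^r * of_nat (i choose r) *
         Gamma ((\<beta> - 3*\<alpha> + of_nat i)/4 + (of_nat r + 1)/2) /
         Gamma ((\<beta> + \<alpha> - 3 * of_nat i)/4 + (of_nat r + 1)/2))"
    unfolding regF_half_plus[OF nonpos(5)[unfolded params] nonpos(4)] params(4,5) args
    by (simp add: rGamma_inverse_Gamma inverse_eq_divide mult_ac atMost_atLeast0)
next
  define \<gamma> where "\<gamma> = - \<alpha> - of_nat i"
  define d where "d = 1 + (\<gamma> + \<beta>) / 2"
  assume conv: "KdF_converges [\<alpha>, - \<alpha> - of_nat i] [] [1 - \<alpha>/2 - of_nat i/2, (- of_nat i - \<alpha> - \<beta>)/2]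
                  [\<beta>] [] [- \<alpha>/2 - of_nat i/2, 1 + (\<beta> - \<alpha> - of_nat i)/2] (1/2) (-1/2)"
    and nonpos: "\<beta> \<notin> \<int>\<^sub>\<le>\<^sub>0" "- \<alpha>/2 - of_nat i/2 \<notin> \<int>\<^sub>\<le>\<^sub>0" "1 + (\<beta> - \<alpha> - of_nat i)/2 \<notin> \<int>\<^sub>\<le>\<^sub>0"
      "1 + (\<beta> - 3*\<alpha> - of_nat i)/2 \<notin> \<int>\<^sub>\<le>\<^sub>0"
  have params: "1 - \<alpha>/2 - of_nat i/2 = 1 + \<gamma> / 2" "- \<alpha>/2 - of_nat i/2 = \<gamma> / 2"
    "1 + (\<beta> - \<alpha> - of_nat i)/2 = d" "1 + (\<beta> - 3*\<alpha> - of_nat i)/2 = d - \<alpha>"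
    "(- of_nat i - \<alpha> - \<beta>)/2 = (\<gamma> - \<beta>) / 2"
    by (simp_all add: \<gamma>_def d_def field_simps)
  have args: "(\<beta> - 3*\<alpha> - of_nat i)/4 + (of_nat r + 1)/2 = (d - \<alpha> + of_nat r) / 2"
    "(\<beta> + \<alpha> - of_nat i)/4 + (of_nat r + 1)/2 = (d + \<alpha> + of_nat r) / 2" for r
    by (simp_all add: \<gamma>_def d_def field_simps)
  have main: "KdF [\<alpha>, \<gamma>] [] [1 + \<gamma> / 2, (\<gamma> - \<beta>) / 2] [\<beta>] [] [\<gamma> / 2, d] (1/2) (-1/2) =
      Gamma d * regF \<alpha> (\<gamma> + 1) d"
    using KdF_eq_Gamma_regF[of \<alpha> \<gamma> \<beta>] conv nonpos unfolding params \<gamma>_def[symmetric] d_def[symmetric] by blast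
  have \<gamma>1: "1 - \<alpha> - of_nat i = \<gamma> + 1"
    by (simp add: \<gamma>_def)
  have "KdF [\<alpha>, - \<alpha> - of_nat i] [] [1 - \<alpha>/2 - of_nat i/2, (- of_nat i - \<alpha> - \<beta>)/2]
        [\<beta>] [] [- \<alpha>/2 - of_nat i/2, 1 + (\<beta> - \<alpha> - of_nat i)/2] (1/2) (-1/2) =
      Gamma d * regF \<alpha> (1 - \<alpha> - of_nat i) d"
    unfolding params \<gamma>_def[symmetric] \<gamma>1 d_def[symmetric] by (rule main)
  thus "KdF [\<alpha>, - \<alpha> - of_nat i] [] [1 - \<alpha>/2 - of_nat i/2, (- of_nat i - \<alpha> - \<beta>)/2]
        [\<beta>] [] [- \<alpha>/2 - of_nat i/2, 1 + (\<beta> - \<alpha> - of_nat i)/2] (1/2) (-1/2)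
    = (2 powr (- of_nat i - \<alpha>) * Gamma (1 + (\<beta> - \<alpha> - of_nat i)/2)) /
      Gamma (1 + (\<beta> - 3*\<alpha> - of_nat i)/2) *
      (\<Sum>r=0..i. of_nat (i choose r) *
         Gamma ((\<beta> - 3*\<alpha> - of_nat i)/4 + (of_nat r + 1)/2) /
         Gamma ((\<beta> + \<alpha> - of_nat i)/4 + (of_nat r + 1)/2))"
    unfolding regF_half_minus[OF nonpos(4)[unfolded params]] params(3,4) args
    by (simp add: rGamma_inverse_Gamma inverse_eq_divide mult_ac atMost_atLeast0)
qed

end
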